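(* Let $U\subseteq R_{a,b}$ be a basepoint free four-dimensional subspace, let $S$ be a nonzero syzygy of $I_U$ of bidegree $(0,n)$, suppose $b\geq 2n-1$ and that $I_U$ has no nonzero syzygy of bidegree $(0,m)$ for $m<n$, and let $V\subseteq U$ be the subspace associated to $S$. Assume $\dim V=4$, and let $\mu_1,\mu_2$ be the integers attached to $S$ defined in the context. Then, besides $S$ in bidegree $(0,n)$, the ideal $I_U$ has syzygies $S_1$ of bidegree $(a,b-n+\mu_1)$, $S_2$ of bidegree $(a,b-n+\mu_2)$, and $S_3$ of bidegree $(a,b-\mu_1-\mu_2)$ such that $$\dim_{\mathbb{K}}\langle S,S_1,S_2,S_3\rangle_{2a-1,b-1}=2ab.$$
   Context: $\mathbb{K}$ is an algebraically closed field, $R=\mathbb{K}[s,t,u,v]$ is bigraded by $\deg s=\deg t=(1,0)$, $\deg u=\deg v=(0,1)$, $R_{c,d}$ is its bidegree $(c,d)$ component, and $A=\mathbb{K}[u,v]\subseteq R$. $a,b\ge1$ are integers, $U\subseteq R_{a,b}$ is a four-dimensional $\mathbb{K}$-subspace with basis $\{p_0,p_1,p_2,p_3\}$, and $I_U=(p_0,p_1,p_2,p_3)\subseteq R$. $U$ is basepoint free if $p_0,\dots,p_3$ have no common zero on $\mathbb{P}^1\times\mathbb{P}^1$ (equivalently $\sqrt{I_U}=(s,t)\cap(u,v)$). A syzygy of $I_U$ (with respect to a given list of four generators) is a column in $R^4$ annihilated by the row of generators; it has bidegree $(c,d)$ if all its entries lie in $R_{c,d}$. $\langle T_1,\dots,T_k\rangle$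 is the $R$-submodule of $R^4$ generated by columns $T_i$, and $\langle T_1,\dots,T_k\rangle_{c,d}$ its component consisting of columns with entries in $R_{c,d}$. Write the $i$th entry of $S$ as $\sum_{j=0}^n a_{ij}u^{n-j}v^j$, $a_{ij}\in\mathbb{K}$; put $f_j=\sum_{i=0}^3a_{ij}p_i$ and $V=\mathrm{Span}_{\mathbb{K}}\{f_0,\dots,f_n\}\subseteq U$. The integers $\mu_1,\mu_2$ (for $\dim V=4$): choose $f_0',f_1',f_2',f_3'$ among $f_0,\dots,f_n$ forming a basis of $V=U$, and let $B$ be the $4\times(n+1)$ matrix over $\mathbb{K}$ with $[f_0'\ f_1'\ f_2'\ f_3']B=[f_0\ \cdots\ f_n]$. Set $[g_0\ g_1\ g_2\ g_3]^T=B[u^n\ u^{n-1}v\ \cdots\ v^n]^T$ (this is $S$ with respect to the generators $f_0',\dots,f_3'$ of $I_U$). The ideal $(g_0,g_1,g_2,g_3)$ of $A$ has height two and a minimal graded free resolution $0\to A(-n-\mu_1)\oplus A(-n-\mu_2)\oplus A(-2n+\mu_1+\mu_2)\to A^4(-n)\to A$ with $1\le\mu_1\le\mu_2\le n-\mu_1-\mu_2$; this defines $\mu_1,\mu_2$. *)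

theory Defs
  imports "HOL-Analysis.Analysis" "HOL-Library.Poly_Mapping"
    "HOL-Computational_Algebra.Polynomial"
begin

section \<open>The bigraded ring \<open>R = K[s,t,u,v]\<close>\<close>

datatype var = Var_s | Var_t | Var_u | Var_v

text \<open>
  A linear order on the variables is only needed for the library instance showing that
  polynomials over a field form an integral domain.
\<close>

instantiation var :: linorder
begin

definition var_index :: "var \<Rightarrow> nat" where
  "var_index x = (case x of Var_s \<Rightarrow> 0 | Var_t \<Rightarrow> 1 | Var_u \<Rightarrow> 2 | Var_v \<Rightarrow> 3)"

definition less_eq_var :: "var \<Rightarrow> var \<Rightarrow> bool" where
  "x \<le> y \<longleftrightarrow> var_index x \<le> var_index y"

definition less_var :: "var \<Rightarrow> var \<Rightarrow> bool" where
  "x < y \<longleftrightarrow> var_index x < var_index y"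

instance
  by standard (auto simp: less_eq_var_def less_var_def var_index_def split: var.splits)

end

type_synonym monom4 = "var \<Rightarrow>\<^sub>0 nat"

type_synonym 'a poly4 = "monom4 \<Rightarrow>\<^sub>0 'a"

definition Const :: "'a::zero \<Rightarrow> 'a poly4" where
  "Const c = Poly_Mapping.single 0 c"

definition uv_monom :: "nat \<Rightarrow> nat \<Rightarrow> monom4" where
  "uv_monom i j = Poly_Mapping.single Var_u i + Poly_Mapping.single Var_v j"

definition bihom :: "nat \<Rightarrow> nat \<Rightarrow> 'a::zero poly4 set" where
  "bihom c d = {p. \<forall>m\<in>Poly_Mapping.keys p.
      Poly_Mapping.lookup m Var_s + Poly_Mapping.lookup m Var_t = c \<and>
      Poly_Mapping.lookup m Var_u + Poly_Mapping.lookup m Var_v = d}"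

text \<open>The subring \<open>A = K[u,v]\<close>; its component of degree \<open>d\<close> is \<^term>\<open>bihom 0 d\<close>.\<close>

definition ring_A :: "'a::zero poly4 set" where
  "ring_A = {p. \<forall>m\<in>Poly_Mapping.keys p.
      Poly_Mapping.lookup m Var_s = 0 \<and> Poly_Mapping.lookup m Var_t = 0}"

definition poly4_eval :: "(var \<Rightarrow> 'a) \<Rightarrow> 'a::comm_semiring_1 poly4 \<Rightarrow> 'a" where
  "poly4_eval x p = (\<Sum>m\<in>Poly_Mapping.keys p. Poly_Mapping.lookup p m *
      (x Var_s ^ Poly_Mapping.lookup m Var_s * x Var_t ^ Poly_Mapping.lookup m Var_t *
       x Var_u ^ Poly_Mapping.lookup m Var_u * x Var_v ^ Poly_Mapping.lookup m Var_v))"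


section \<open>Linear structures\<close>

definition smult_K :: "'a::comm_ring_1 \<Rightarrow> 'a poly4 \<Rightarrow> 'a poly4" where
  "smult_K c p = Const c * p"

definition smult_col_K :: "'a::comm_ring_1 \<Rightarrow> 'a poly4 ^ 'n \<Rightarrow> 'a poly4 ^ 'n" where
  "smult_col_K c x = Const c *s x"

lemma Const_add: "Const (c + d) = Const c + Const d"
  by (simp add: Const_def single_add)

lemma Const_mult: "Const (c * d) = Const c * (Const d :: 'a::comm_ring_1 poly4)"
  by (simp add: Const_def mult_single)

lemma Const_1: "Const (1 :: 'a::comm_ring_1) = 1"
  by (simp add: Const_def)

global_interpretation K_poly: vector_space "smult_K :: 'a::field \<Rightarrow> 'a poly4 \<Rightarrow> 'a poly4"
  by standard (simp_all add: smult_K_def Const_add Const_mult Const_1 algebra_simps)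

global_interpretation K_col: vector_space
  "smult_col_K :: 'a::field \<Rightarrow> 'a poly4 ^ 'n \<Rightarrow> 'a poly4 ^ 'n"
  by standard (simp_all add: smult_col_K_def Const_add Const_mult Const_1 vec_eq_iff algebra_simps)

global_interpretation R_col: module
  "(*s) :: 'a::field poly4 \<Rightarrow> 'a poly4 ^ 'n \<Rightarrow> 'a poly4 ^ 'n"
  by standard (simp_all add: vec_eq_iff algebra_simps)

definition bihom_col :: "nat \<Rightarrow> nat \<Rightarrow> ('a::zero poly4 ^ 'n) set" where
  "bihom_col c d = {x. \<forall>i. x $ i \<in> bihom c d}"


section \<open>Basepoint free subspaces and syzygies\<close>

text \<open>A basis as a family: its members are in particular pairwise distinct.\<close>

definition basis_family :: "'a::field poly4 ^ 'n \<Rightarrow> 'a poly4 set \<Rightarrow> bool" where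
  "basis_family p U \<longleftrightarrow> inj (\<lambda>i. p $ i) \<and>
     \<not> K_poly.dependent (range (\<lambda>i. p $ i)) \<and> K_poly.span (range (\<lambda>i. p $ i)) = U"

text \<open>
  Points of \<open>P\<^sup>1 \<times> P\<^sup>1\<close> are given by homogeneous coordinates; vanishing of bihomogeneous
  polynomials does not depend on their choice.
\<close>

definition basepoint_free :: "'a::field poly4 set \<Rightarrow> bool" where
  "basepoint_free U \<longleftrightarrow> \<not> (\<exists>x :: var \<Rightarrow> 'a.
     (x Var_s, x Var_t) \<noteq> (0, 0) \<and> (x Var_u, x Var_v) \<noteq> (0, 0) \<and> (\<forall>p\<in>U. poly4_eval x p = 0))"

definition is_syzygy :: "'a::comm_ring_1 poly4 ^ 'n \<Rightarrow> 'a poly4 ^ 'n \<Rightarrow> bool" where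
  "is_syzygy p T \<longleftrightarrow> (\<Sum>i\<in>UNIV. p $ i * T $ i) = 0"

definition is_syzygy_of_bidegree ::
  "'a::comm_ring_1 poly4 ^ 'n \<Rightarrow> nat \<Rightarrow> nat \<Rightarrow> 'a poly4 ^ 'n \<Rightarrow> bool" where
  "is_syzygy_of_bidegree p c d T \<longleftrightarrow> is_syzygy p T \<and> T \<in> bihom_col c d"


section \<open>The subspace attached to a syzygy of bidegree \<open>(0,n)\<close>\<close>

text \<open>
  The coefficient \<open>a\<^sub>i\<^sub>j\<close> of \<open>u\<^sup>n\<^sup>-\<^sup>j v\<^sup>j\<close> in the \<open>i\<close>-th entry of \<open>S\<close>, and
  \<open>f\<^sub>j = \<Sum>\<^sub>i a\<^sub>i\<^sub>j p\<^sub>i\<close>; both are meaningful for \<open>j \<le> n\<close> only.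
\<close>

definition syz_coeff :: "'a::zero poly4 ^ 'n \<Rightarrow> nat \<Rightarrow> 'n \<Rightarrow> nat \<Rightarrow> 'a" where
  "syz_coeff S n i j = Poly_Mapping.lookup (S $ i) (uv_monom (n - j) j)"

definition assoc_f :: "'a::comm_ring_1 poly4 ^ 'n \<Rightarrow> 'a poly4 ^ 'n \<Rightarrow> nat \<Rightarrow> nat \<Rightarrow> 'a poly4" where
  "assoc_f p S n j = (\<Sum>i\<in>UNIV. smult_K (syz_coeff S n i j) (p $ i))"

definition assoc_V :: "'a::field poly4 ^ 'n \<Rightarrow> 'a poly4 ^ 'n \<Rightarrow> nat \<Rightarrow> 'a poly4 set" where
  "assoc_V p S n = K_poly.span (assoc_f p S n ` {..n})"


section \<open>The integers \<open>\<mu>\<^sub>1, \<mu>\<^sub>2\<close>\<close>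

text \<open>
  \<open>0 \<rightarrow> \<Oplus>\<^sub>j A(-d\<^sub>j) \<rightarrow> \<Oplus>\<^sub>i A(-e\<^sub>i) \<rightarrow> A\<close> is a minimal graded free resolution (of \<open>A/(g\<^sub>i)\<^sub>i\<close>), where
  the right map is the row \<open>g\<close> and the left one the matrix \<open>M\<close>. The maps have degree 0: \<open>g\<^sub>i\<close> has
  degree \<open>e\<^sub>i\<close> and \<open>M\<^sub>i\<^sub>j\<close> has degree \<open>d\<^sub>j - e\<^sub>i\<close>, hence is zero if this is negative. Minimality
  means that all entries lie in the ideal \<open>(u,v)\<close>, i.e. have no constant term.
\<close>

definition minimal_graded_free_resolution ::
  "nat ^ 'm \<Rightarrow> nat ^ 'n \<Rightarrow> 'a::field poly4 ^ 'm ^ 'n \<Rightarrow> 'a poly4 ^ 'n \<Rightarrow> bool" where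
  "minimal_graded_free_resolution d e M g \<longleftrightarrow>
     (\<forall>i. g $ i \<in> bihom 0 (e $ i)) \<and>
     (\<forall>i j. if e $ i \<le> d $ j then M $ i $ j \<in> bihom 0 (d $ j - e $ i) else M $ i $ j = 0) \<and>
     inj_on ((*v) M) {x. \<forall>j. x $ j \<in> ring_A} \<and>
     (*v) M ` {x. \<forall>j. x $ j \<in> ring_A} =
       {y. (\<forall>i. y $ i \<in> ring_A) \<and> (\<Sum>i\<in>UNIV. g $ i * y $ i) = 0} \<and>
     (\<forall>i. Poly_Mapping.lookup (g $ i) 0 = 0) \<and>
     (\<forall>i j. Poly_Mapping.lookup (M $ i $ j) 0 = 0)"

text \<open>
  The natural number subtractions do not truncate: \<open>1 \<le> n - \<mu>\<^sub>1 - \<mu>\<^sub>2\<close> forces \<open>\<mu>\<^sub>1 + \<mu>\<^sub>2 < n\<close>.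
\<close>

definition assoc_mu ::
  "'a::field poly4 ^ 4 \<Rightarrow> 'a poly4 ^ 4 \<Rightarrow> nat \<Rightarrow> nat \<Rightarrow> nat \<Rightarrow> bool" where
  "assoc_mu p S n \<mu>1 \<mu>2 \<longleftrightarrow>
     1 \<le> \<mu>1 \<and> \<mu>1 \<le> \<mu>2 \<and> \<mu>2 \<le> n - \<mu>1 - \<mu>2 \<and>
     (\<exists>(f' :: 'a poly4 ^ 4) (B :: 4 \<Rightarrow> nat \<Rightarrow> 'a) (g :: 'a poly4 ^ 4) (M :: 'a poly4 ^ 3 ^ 4).
        (\<forall>i. f' $ i \<in> assoc_f p S n ` {..n}) \<and>
        basis_family f' (assoc_V p S n) \<and>
        (\<forall>j\<le>n. assoc_f p S n j = (\<Sum>i\<in>UNIV. smult_K (B i j) (f' $ i))) \<and>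
        (\<forall>i. g $ i = (\<Sum>j\<le>n. Poly_Mapping.single (uv_monom (n - j) j) (B i j))) \<and>
        minimal_graded_free_resolution
          (vector [n + \<mu>1, n + \<mu>2, 2 * n - \<mu>1 - \<mu>2]) (\<chi> i. n) M g)"

end

theory Submission
  imports Defs
begin

text \<open>
  Let \<open>f\<close> be the basis of \<open>U\<close> for which the resolution is given, so that the coordinates \<open>g\<close> of \<open>S\<close>
  satisfy \<open>\<Sum>\<^sub>i g\<^sub>i f\<^sub>i = 0\<close>, and let \<open>M\<close> be the \<open>4 \<times> 3\<close> matrix of the resolution of the ideal of \<open>g\<close>, with
  columns of degrees \<open>\<mu>\<^sub>1, \<mu>\<^sub>2, \<mu>\<^sub>3\<close> and \<open>\<mu>\<^sub>1 + \<mu>\<^sub>2 + \<mu>\<^sub>3 = n\<close>. Read the equation the other way round: \<open>f\<close>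
  is a syzygy of \<open>g\<close>, over \<open>R = A[s,t]\<close>. Hence \<open>f = M h\<close> with three forms \<open>h\<^sub>k\<close> of bidegree
  \<open>(a, b - \<mu>\<^sub>k)\<close>. A column \<open>T\<close> is a syzygy of \<open>f\<close> precisely when \<open>M\<^sup>t T\<close> is a syzygy of \<open>h\<close>. The kernel
  of \<open>M\<^sup>t\<close> is \<open>R g\<close>, which accounts for \<open>S\<close>. The other three syzygies are lifts of the Koszul
  syzygies of \<open>h\<close>; the lift of the one avoiding position \<open>k\<close> has bidegree \<open>(a, b - n + \<mu>\<^sub>k)\<close>.

  Lifts exist because \<open>M\<^sup>t\<close> is surjective onto the degrees that are needed (\<open>dual_onto\<close>). This is a
  count of dimensions that needs exactness of the dual complex (\<open>dual_exact\<close>), and this in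
  turn follows from \<open>g\<close> having no common zero, which is again a count of dimensions, for the
  resolution itself (\<open>generators_onto\<close>). Both counts are instances of \<open>matrix_onto_pbox\<close>.

  For the dimension one shows that there is no relation \<open>q S + \<Sum>\<^sub>k r\<^sub>k S\<^sub>k = 0\<close> in bidegree
  \<open>(2a - 1, b - 1)\<close>. Applying \<open>M\<^sup>t\<close> gives a relation of the Koszul syzygies, i.e. \<open>r\<close> is
  proportional to \<open>h\<close>; but on each line with fixed \<open>(u : v)\<close> the vector \<open>h\<close> has no zero, by
  basepoint freeness, and degree \<open>a\<close> in \<open>s, t\<close>, while \<open>r\<close> has degree \<open>a - 1\<close>. Therefore \<open>r = 0\<close>
  and \<open>q = 0\<close> (\<open>syzygies_from_koszul\<close>). The component is then a direct sum
  (\<open>dim_span_bihom_component\<close>) of dimension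
  \<open>2a(b - n) + a \<Sum>\<^sub>k (n - \<mu>\<^sub>k) = 2a(b - n) + 2an = 2ab\<close>.

  All computations take place after the substitution \<open>t = v = 1\<close>, which turns a component of \<open>R\<close>
  into a space of polynomials in \<open>s\<close> and \<open>u\<close> with bounded degrees, and a component of \<open>A\<close> into a
  space of univariate polynomials.
\<close>

section \<open>Dimension counting\<close>

text \<open>
  Two equal members would give a combination with coefficients \<open>1\<close> and \<open>-1\<close>, so injectivity of
  the family comes for free. For monomial bases this allows to count indices instead of vectors.
\<close>

lemma (in vector_space) independent_family:
  assumes "finite I" and "\<And>c. (\<Sum>k\<in>I. scale (c k) (e k)) = 0 \<Longrightarrow> \<forall>k\<in>I. c k = 0"
  shows "inj_on e I" and "independent (e ` I)"
proof -
  show inj: "inj_on e I"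
  proof (rule inj_onI, rule ccontr)
    fix x y assume xy: "x \<in> I" "y \<in> I" "e x = e y" "x \<noteq> y"
    let ?c = "\<lambda>k. (if k = x then 1 else 0) - (if k = y then 1 else 0)"
    have "(\<Sum>k\<in>I. scale (?c k) (e k)) = 0"
      using assms(1) xy
      by (simp add: scale_left_diff_distrib sum_subtractf if_distrib[of "\<lambda>t. scale t _"] cong: if_cong)
    from assms(2)[OF this] xy show False by auto
  qed
  show "independent (e ` I)"
  proof (rule independent_if_scalars_zero)
    show "finite (e ` I)" using assms(1) by simp
    fix f x assume "(\<Sum>x\<in>e ` I. scale (f x) x) = 0" "x \<in> e ` I"
    then show "f x = 0" using assms(2)[of "f \<circ> e"] by (auto simp: sum.reindex[OF inj])
  qed
qed

lemma (in vector_space) dim_span_family: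
  assumes "finite I" and "\<And>c. (\<Sum>k\<in>I. scale (c k) (e k)) = 0 \<Longrightarrow> \<forall>k\<in>I. c k = 0"
  shows "dim (span (e ` I)) = card I"
  using independent_family[OF assms] by (simp add: dim_eq_card_independent card_image)

text \<open>
  Rank and nullity in spaces of infinite dimension, phrased with spanning sets and independent
  sets so that no dimension has to be computed. If \<open>w\<close> were missed, a basis of the image
  together with \<open>w\<close> would be independent in \<open>Y\<close>, so the image would have fewer than
  \<open>card E\<close> basis vectors. Preimages of these and \<open>Z\<close> then span \<open>X\<close>, which is too few vectors
  for the independent set \<open>B\<close>.
\<close>

lemma (in vector_space_pair) onto_by_dimension_count:
  assumes f: "Vector_Spaces.linear s1 s2 f" and X: "vs1.subspace X" and XY: "f ` X \<subseteq> Y"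
    and Y: "Y \<subseteq> vs2.span E" "finite E"
    and B: "vs1.independent B" "B \<subseteq> X"
    and ker: "{x \<in> X. f x = 0} \<subseteq> vs1.span Z" "finite Z"
    and count: "card Z + card E \<le> card B"
  shows "Y \<subseteq> f ` X"
proof (rule subsetI, rule ccontr)
  fix w assume w: "w \<in> Y" "w \<notin> f ` X"
  have sub: "vs2.subspace (f ` X)" by (rule linear_subspace_image[OF f X])
  obtain C where C: "C \<subseteq> f ` X" "vs2.independent C" "f ` X \<subseteq> vs2.span C"
    using vs2.basis_exists by metis
  have "vs2.span C \<subseteq> f ` X" using C(1) sub by (rule vs2.span_minimal)
  with w have "vs2.independent (insert w C)" using C(2) vs2.independent_insertI[of w C] by blast
  moreover have "insert w C \<subseteq> vs2.span E" using w C(1) XY Y by auto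
  ultimately have "finite (insert w C) \<and> card (insert w C) \<le> card E"
    by (rule vs2.independent_span_bound[OF Y(2)])
  then have fin: "finite C" and "card (insert w C) \<le> card E" by auto
  moreover have "w \<notin> C" using w(2) C(1) by auto
  ultimately have cC: "card C + 1 \<le> card E" by simp
  obtain D where D: "D \<subseteq> X" "f ` D = C" "inj_on f D"
    using C(1) by (metis subset_image_inj)
  have D': "finite D" "card D = card C" using D fin by (auto simp: finite_image_iff card_image)
  have "X \<subseteq> vs1.span (Z \<union> D)"
  proof
    fix x assume x: "x \<in> X"
    then have "f x \<in> vs2.span (f ` D)" using C(3) D(2) by auto
    then obtain d where d: "d \<in> vs1.span D" "f x = f d"
      using linear_span_image[OF f, of D] by auto
    have "d \<in> X" using vs1.span_minimal[OF D(1) X] d(1) by auto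
    then have "x - d \<in> {x \<in> X. f x = 0}"
      using x d(2) X by (auto simp: linear_diff[OF f] vs1.subspace_diff)
    then have "x - d \<in> vs1.span (Z \<union> D)" using ker(1) vs1.span_mono[of Z "Z \<union> D"] by auto
    moreover have "d \<in> vs1.span (Z \<union> D)" using d(1) vs1.span_mono[of D "Z \<union> D"] by auto
    ultimately show "x \<in> vs1.span (Z \<union> D)" using vs1.span_add by force
  qed
  then have "card B \<le> card (Z \<union> D)"
    using vs1.independent_span_bound[OF _ B(1), of "Z \<union> D"] B(2) ker(2) D'(1) by auto
  also have "\<dots> \<le> card Z + card D" by (rule card_Un_le)
  finally show False using cC D'(2) count by simp
qed


section \<open>Vectors of polynomials with bounded degrees\<close>

text \<open>
  The bound is strict, so \<open>polys_below m\<close> has dimension \<open>m\<close> and \<open>polys_below 0\<close> is the zero space.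
  With this convention a component \<open>A\<^bsub>d - e\<^esub>\<close> of the graded ring \<open>A\<close> with \<open>d < e\<close> is
  described correctly by the truncated subtraction of natural numbers.
\<close>
definition polys_below :: "nat \<Rightarrow> 'a::zero poly set" where
  "polys_below m = {p. \<forall>j\<ge>m. coeff p j = 0}"

lemma polys_below_0 [simp]: "p \<in> polys_below 0 \<longleftrightarrow> p = 0"
  by (auto simp: polys_below_def poly_eq_iff)

lemma zero_polys_below [simp]: "0 \<in> polys_below m"
  by (simp add: polys_below_def)

lemma polys_below_iff_degree: "0 < m \<Longrightarrow> p \<in> polys_below m \<longleftrightarrow> degree p < m"
  by (auto simp: polys_below_def intro: coeff_eq_0 order.strict_trans2)
     (metis leading_coeff_0_iff degree_0 not_le)

lemma polys_below_uminus: "p \<in> polys_below m \<Longrightarrow> - (p::'a::ab_group_add poly) \<in> polys_below m"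
  by (auto simp: polys_below_def)

lemma polys_below_sum: "(\<And>i. i \<in> A \<Longrightarrow> f i \<in> polys_below m) \<Longrightarrow> sum f A \<in> polys_below m"
  by (auto simp: polys_below_def coeff_sum intro!: sum.neutral)

lemma polys_below_mult:
  fixes p q :: "'a::comm_semiring_0 poly"
  assumes "p \<in> polys_below m" "q \<in> polys_below (Suc d)"
  shows "p * q \<in> polys_below (m + d)"
proof -
  have "coeff p i * coeff q (j - i) = 0" if "m + d \<le> j" for i j
    using assms that by (cases "m \<le> i") (auto simp: polys_below_def)
  then show ?thesis by (auto simp: polys_below_def coeff_mult intro!: sum.neutral)
qed

definition scale_pvec :: "'a::comm_ring_1 \<Rightarrow> 'a poly ^ 'n \<Rightarrow> 'a poly ^ 'n" where
  "scale_pvec c x = (\<chi> i. smult c (x $ i))"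

lemma scale_pvec_nth [simp]: "scale_pvec c x $ i = smult c (x $ i)"
  by (simp add: scale_pvec_def)

global_interpretation pvec: vector_space "scale_pvec :: 'a::field \<Rightarrow> 'a poly ^ 'n \<Rightarrow> 'a poly ^ 'n"
  by standard (simp_all add: vec_eq_iff smult_add_right smult_add_left)

global_interpretation pvec_pair: vector_space_pair
  "scale_pvec :: 'a::field \<Rightarrow> 'a poly ^ 'n \<Rightarrow> 'a poly ^ 'n"
  "scale_pvec :: 'a::field \<Rightarrow> 'a poly ^ 'm \<Rightarrow> 'a poly ^ 'm"
  by standard

definition pbox :: "('n \<Rightarrow> nat) \<Rightarrow> ('a::zero poly ^ 'n) set" where
  "pbox m = {x. \<forall>i. x $ i \<in> polys_below (m i)}"

definition pbox_unit :: "'n \<times> nat \<Rightarrow> 'a::field poly ^ 'n" where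
  "pbox_unit = (\<lambda>(i, j). axis i (monom 1 j))"

definition pbox_index :: "('n \<Rightarrow> nat) \<Rightarrow> ('n \<times> nat) set" where
  "pbox_index m = (SIGMA i:UNIV. {..<m i})"

lemma finite_pbox_index [simp]: "finite (pbox_index (m :: 'n::finite \<Rightarrow> nat))"
  by (simp add: pbox_index_def)

lemma card_pbox_index: "card (pbox_index (m :: 'n::finite \<Rightarrow> nat)) = sum m UNIV"
  by (simp add: pbox_index_def)

lemma coeff_sum_pbox_unit:
  fixes m :: "'n::finite \<Rightarrow> nat" and c :: "'n \<times> nat \<Rightarrow> 'a::field"
  shows "coeff ((\<Sum>k\<in>pbox_index m. scale_pvec (c k) (pbox_unit k)) $ i) j
           = (if j < m i then c (i, j) else 0)"
proof -
  have "coeff ((pbox_unit k :: 'a poly ^ 'n) $ i) j = (if k = (i, j) then 1 else 0)" for k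
    by (cases k) (auto simp: pbox_unit_def axis_def)
  note unit = this
  have "coeff ((\<Sum>k\<in>pbox_index m. scale_pvec (c k) (pbox_unit k)) $ i) j
      = (\<Sum>k\<in>pbox_index m. if k = (i, j) then c k else 0)"
    by (simp add: coeff_sum unit if_distrib[of "\<lambda>t. _ * t"] del: sum.delta cong: if_cong)
  also have "\<dots> = (if (i, j) \<in> pbox_index m then c (i, j) else 0)"
    by simp
  finally show ?thesis by (simp add: pbox_index_def)
qed

lemma pbox_unit_independent:
  "pvec.independent (pbox_unit ` pbox_index m :: ('a::field poly ^ 'n::finite) set)"
  and inj_on_pbox_unit: "inj_on (pbox_unit :: _ \<Rightarrow> 'a::field poly ^ 'n::finite) (pbox_index m)"
proof -
  have "\<forall>k\<in>pbox_index m. c k = 0"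
    if "(\<Sum>k\<in>pbox_index m. scale_pvec (c k) (pbox_unit k)) = (0 :: 'a poly ^ 'n)" for c
  proof
    fix k assume "k \<in> pbox_index m"
    then show "c k = 0"
      using coeff_sum_pbox_unit[of c m "fst k" "snd k"] unfolding that
      by (auto simp: pbox_index_def)
  qed
  from pvec.independent_family[OF finite_pbox_index this]
  show "pvec.independent (pbox_unit ` pbox_index m :: ('a poly ^ 'n) set)"
    "inj_on (pbox_unit :: _ \<Rightarrow> 'a poly ^ 'n) (pbox_index m)" by blast+
qed

lemma pbox_subset_span:
  "pbox m \<subseteq> pvec.span (pbox_unit ` pbox_index m :: ('a::field poly ^ 'n::finite) set)"
proof
  fix x :: "'a poly ^ 'n" assume x: "x \<in> pbox m"
  have "x = (\<Sum>k\<in>pbox_index m. scale_pvec (coeff (x $ fst k) (snd k)) (pbox_unit k))"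
    using x by (auto simp: vec_eq_iff poly_eq_iff coeff_sum_pbox_unit pbox_def polys_below_def
        simp del: sum_component)
  also have "\<dots> \<in> pvec.span (pbox_unit ` pbox_index m)"
    by (intro pvec.span_sum pvec.span_scale pvec.span_base imageI)
  finally show "x \<in> pvec.span (pbox_unit ` pbox_index m)" .
qed

lemma pbox_unit_in_pbox: "pbox_unit ` pbox_index m \<subseteq> pbox (m :: 'n::finite \<Rightarrow> nat)"
  by (auto simp: pbox_unit_def pbox_index_def pbox_def polys_below_def axis_def)

lemma subspace_pbox: "pvec.subspace (pbox m)"
  by (auto simp: pvec.subspace_def pbox_def polys_below_def)

lemma linear_matrix_pvec:
  fixes A :: "'a::field poly ^ 'n ^ 'm"
  shows "Vector_Spaces.linear scale_pvec scale_pvec (\<lambda>x. A *v x)"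
proof -
  have "A *v scale_pvec c x = scale_pvec c (A *v x)" for c x
    by (auto simp: matrix_vector_mult_def vec_eq_iff poly_eq_iff coeff_sum sum_distrib_left)
  then show ?thesis
    by (simp add: Vector_Spaces.linear_iff pvec.vector_space_axioms matrix_vector_right_distrib)
qed

text \<open>
  The dimension of \<open>pbox m\<close> is the sum of the bounds \<open>m\<close>. In a three term complex of polynomial
  matrices that is exact in the middle, the count therefore leaves no room for a cokernel of the
  last map. The resolution and its dual are both treated in this way.
\<close>

lemma matrix_onto_pbox:
  fixes A :: "'a::field poly ^ 'n ^ 'm" and C :: "'a poly ^ 'l ^ 'n"
  assumes into: "\<And>x. x \<in> pbox m \<Longrightarrow> A *v x \<in> pbox m'"
    and exact: "\<And>x. x \<in> pbox m \<Longrightarrow> A *v x = 0 \<Longrightarrow> \<exists>y\<in>pbox k. C *v y = x"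
    and count: "sum k UNIV + sum m' UNIV \<le> sum m UNIV"
    and w: "w \<in> pbox m'"
  shows "\<exists>x\<in>pbox m. A *v x = w"
proof -
  let ?Z = "(\<lambda>y. C *v y) ` (pbox_unit ` pbox_index k)"
  have "pbox m' \<subseteq> (\<lambda>x. A *v x) ` pbox m"
  proof (rule pvec_pair.onto_by_dimension_count[OF linear_matrix_pvec subspace_pbox])
    show "(\<lambda>x. A *v x) ` pbox m \<subseteq> pbox m'" using into by auto
    show "pbox m' \<subseteq> pvec.span (pbox_unit ` pbox_index m')" by (rule pbox_subset_span)
    show "pvec.independent (pbox_unit ` pbox_index m :: ('a poly ^ 'n) set)"
      by (rule pbox_unit_independent)
    show "pbox_unit ` pbox_index m \<subseteq> (pbox m :: ('a poly ^ 'n) set)"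
      by (rule pbox_unit_in_pbox)
    show "{x \<in> pbox m. A *v x = 0} \<subseteq> pvec.span ?Z"
      using exact pbox_subset_span[of k]
      by (fastforce simp: pvec_pair.linear_span_image[OF linear_matrix_pvec])
    have "card ?Z \<le> sum k UNIV"
      by (metis card_image_le card_pbox_index finite_imageI finite_pbox_index order_trans)
    moreover have "card (pbox_unit ` pbox_index m' :: ('a poly ^ 'm) set) = sum m' UNIV"
      "card (pbox_unit ` pbox_index m :: ('a poly ^ 'n) set) = sum m UNIV"
      by (simp_all add: card_image[OF inj_on_pbox_unit] card_pbox_index)
    ultimately show "card ?Z + card (pbox_unit ` pbox_index m' :: ('a poly ^ 'm) set)
        \<le> card (pbox_unit ` pbox_index m :: ('a poly ^ 'n) set)"
      using count by simp
  qed auto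
  with w show ?thesis by auto
qed

section \<open>Parallel vectors of univariate polynomials\<close>

text \<open>
  If \<open>K\<close> were finite, one plus the product of all \<open>X - x\<close> would have no root.
\<close>

lemma infinite_UNIV_alg_closed: "infinite (UNIV :: 'a::alg_closed_field set)"
proof
  assume fin: "finite (UNIV :: 'a set)"
  let ?q = "\<Prod>x\<in>(UNIV :: 'a set). [:- x, 1:]"
  have "degree ?q = card (UNIV :: 'a set)"
    by (subst degree_prod_eq_sum_degree) auto
  then have "degree (?q + 1) = card (UNIV :: 'a set)" and "card (UNIV :: 'a set) > 0"
    using fin by (auto simp: degree_add_eq_left card_gt_0_iff)
  then obtain x where "poly (?q + 1) x = 0"
    using alg_closed_imp_poly_has_root[of "?q + 1"] by auto
  moreover have "poly ?q x = 0" using fin by (auto simp: poly_prod prod_zero_iff)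
  ultimately show False by simp
qed

text \<open>
  The vector \<open>h\<close> describes a map from \<open>P\<^sup>1\<close> that is defined everywhere: no common root at finite
  distance, and a nonzero coefficient of degree \<open>a\<close> at infinity. A vector \<open>r\<close> proportional to it
  must be a polynomial multiple \<open>l h\<close>, since a pole of \<open>r/h\<close> would be a common zero of \<open>h\<close>. For
  \<open>d = a\<close> there is no room for \<open>l\<close>, and \<open>r = 0\<close>.
\<close>

lemma parallel_to_base_point_free_vector:
  fixes h r :: "'a::alg_closed_field poly ^ 'n"
  assumes par: "\<And>i j. r $ i * h $ j = r $ j * h $ i"
    and nz: "\<And>x. \<exists>j. poly (h $ j) x \<noteq> 0"
    and deg: "\<And>i. h $ i \<in> polys_below (Suc a)" "coeff (h $ i0) a \<noteq> 0"
    and r: "\<And>i. r $ i \<in> polys_below d"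
  shows "\<exists>l\<in>polys_below (d - a). \<forall>i. r $ i = l * h $ i"
proof -
  \<comment> \<open>Remove the roots of \<open>h $ i0\<close> one at a time: at each of them some other entry of \<open>h\<close> does not
    vanish, so that proportionality forces the root on \<open>r $ i0\<close>.\<close>
  have div: "q dvd r $ i0" if "q dvd h $ i0" for q
    using that
  proof (induction "degree q" arbitrary: q)
    case 0
    moreover have "q \<noteq> 0" using 0 deg(2) by auto
    ultimately show ?case by (metis is_unit_iff_degree unit_imp_dvd)
  next
    case (Suc e)
    obtain x where "poly q x = 0" using alg_closed_imp_poly_has_root[of q] Suc(2) by auto
    then obtain q' where q': "q = [:- x, 1:] * q'" by (auto simp: poly_eq_0_iff_dvd elim: dvdE)
    have "q' \<noteq> 0" using Suc(2) q' by auto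
    then have "degree q = Suc (degree q')" unfolding q' by (subst degree_mult_eq) auto
    then have "q' dvd r $ i0" using Suc q' by (metis dvd_mult_right nat.inject)
    then obtain r' where r': "r $ i0 = q' * r'" by (auto elim: dvdE)
    obtain h' where h': "h $ i0 = q * h'" using Suc(3) by (auto elim: dvdE)
    obtain j where j: "poly (h $ j) x \<noteq> 0" using nz by blast
    have "q' * (r' * h $ j) = q' * (r $ j * [:- x, 1:] * h')"
      using par[of i0 j] unfolding r' h' q' by (simp only: mult_ac)
    then have "r' * h $ j = r $ j * [:- x, 1:] * h'" using \<open>q' \<noteq> 0\<close> by (metis mult_left_cancel)
    then have "poly r' x * poly (h $ j) x = 0" 
      by (simp flip: poly_mult) simp
    then have "[:- x, 1:] dvd r'" using j by (auto simp: poly_eq_0_iff_dvd)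
    then show ?case unfolding r' q' by (metis mult.commute mult_dvd_mono dvd_refl)
  qed
  obtain l where l: "r $ i0 = h $ i0 * l" using div[of "h $ i0"] by (auto elim: dvdE)
  have h0: "h $ i0 \<noteq> 0" using deg(2) by auto
  have "r $ i = l * h $ i" for i
  proof -
    have "h $ i0 * r $ i = h $ i0 * (l * h $ i)" using par[of i0 i] unfolding l by (simp only: mult_ac)
    then show ?thesis using h0 by (metis mult_left_cancel)
  qed
  moreover have "l \<in> polys_below (d - a)"
  proof (cases "l = 0")
    case False
    have "degree (h $ i0) \<ge> a" using deg(2) by (auto intro: le_degree)
    moreover have "degree (r $ i0) = degree (h $ i0) + degree l"
      using l h0 False by (simp add: degree_mult_eq)
    moreover have "r $ i0 \<noteq> 0" using l h0 False by simp
    then have "degree (r $ i0) < d"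
      using r[of i0] polys_below_iff_degree[of d "r $ i0"] by (cases "d = 0") auto
    ultimately show ?thesis by (subst polys_below_iff_degree) auto
  qed simp
  ultimately show ?thesis by blast
qed


section \<open>The resolution of a height two ideal and its dual\<close>

text \<open>
  A graded resolution \<open>0 \<rightarrow> \<Oplus>\<^sub>k A(-n-\<mu>\<^sub>k) \<rightarrow> A(-n)\<^sup>m\<^sup>+\<^sup>1 \<rightarrow> A\<close> after the substitution \<open>v = 1\<close>; homogeneity
  has become the degree bounds. The column \<open>\<Gamma>\<close> holds the generators and \<open>N\<close> their syzygies.
  That the \<open>\<mu>\<^sub>k\<close> add up to \<open>n\<close> is the numerical form of height two: for injective \<open>N\<close> it makes
  the Hilbert polynomial of \<open>A\<close> modulo the generators vanish.
\<close>
locale hilbert_burch =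
  fixes \<Gamma> :: "'a::alg_closed_field poly ^ 1 ^ 'n" and N :: "'a poly ^ 'm ^ 'n"
    and \<mu> :: "'m \<Rightarrow> nat" and n :: nat
  assumes card_rows: "CARD('n) = Suc CARD('m)"
    and sum_mu: "sum \<mu> UNIV = n" and n_pos: "0 < n"
    and deg_gen: "\<Gamma> $ i $ 1 \<in> polys_below (Suc n)"
    and deg_syz: "N $ i $ k \<in> polys_below (Suc (\<mu> k))"
    and complex: "(N *v y) v* \<Gamma> = 0"
    and exact: "x \<in> pbox (\<lambda>_. d) \<Longrightarrow> x v* \<Gamma> = 0 \<Longrightarrow> \<exists>y\<in>pbox (\<lambda>k. d - \<mu> k). N *v y = x"
begin

lemma mu_le: "\<mu> k \<le> n"
  unfolding sum_mu[symmetric] by (rule member_le_sum) auto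

lemma gen_pbox: "x \<in> pbox (\<lambda>_. d) \<Longrightarrow> x v* \<Gamma> \<in> pbox (\<lambda>_. d + n)"
  using deg_gen
  by (auto simp: pbox_def vector_matrix_mult_def forall_1 mult.commute[of "\<Gamma> $ _ $ _"]
      intro!: polys_below_sum polys_below_mult)

lemma syz_pbox: "x \<in> pbox (\<lambda>_. d) \<Longrightarrow> x v* N \<in> pbox (\<lambda>k. d + \<mu> k)"
  using deg_syz
  by (auto simp: pbox_def vector_matrix_mult_def mult.commute[of "N $ _ $ _"]
      intro!: polys_below_sum polys_below_mult)

text \<open>
  By counting, the ideal of the generators contains everything of degree \<open>2n - 1\<close>. This replaces
  the assertion that the ideal has height two: evaluated at a point it says that the generators
  have no common zero, neither at finite distance nor at infinity.
\<close>

lemma generators_onto: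
  assumes "w \<in> polys_below (2 * n)"
  shows "\<exists>x\<in>pbox (\<lambda>_. n). (\<Sum>i\<in>UNIV. \<Gamma> $ i $ 1 * x $ i) = w"
proof -
  have "\<exists>x\<in>pbox (\<lambda>_. n). transpose \<Gamma> *v x = (\<chi> _. w)"
  proof (rule matrix_onto_pbox)
    show "transpose \<Gamma> *v x \<in> pbox (\<lambda>_. 2 * n)" if "x \<in> pbox (\<lambda>_. n)" for x
      using gen_pbox[OF that] by (simp add: mult_2)
    show "\<exists>y\<in>pbox (\<lambda>k. n - \<mu> k). N *v y = x"
      if "x \<in> pbox (\<lambda>_. n)" "transpose \<Gamma> *v x = 0" for x
      using exact[OF that(1)] that(2) by simp
    have "(\<Sum>k\<in>UNIV. n - \<mu> k) = CARD('m) * n - n"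
      using mu_le by (subst sum_subtractf_nat) (auto simp: sum_mu)
    moreover have "n \<le> CARD('m) * n" by (simp add: Suc_leI)
    ultimately show "(\<Sum>k\<in>UNIV. n - \<mu> k) + (\<Sum>k\<in>(UNIV :: 1 set). 2 * n) \<le> (\<Sum>i\<in>(UNIV :: 'n set). n)"
      by (simp add: card_rows)
    show "(\<chi> _. w) \<in> pbox (\<lambda>_::1. 2 * n)" using assms by (simp add: pbox_def)
  qed
  then show ?thesis by (auto simp: vector_matrix_mult_def vec_eq_iff mult.commute)
qed

lemma generators_no_common_root: "\<exists>i. poly (\<Gamma> $ i $ 1) x \<noteq> 0"
proof (rule ccontr)
  assume *: "\<not> ?thesis"
  have "1 \<in> polys_below (2 * n)" using n_pos by (simp add: polys_below_iff_degree)
  from generators_onto[OF this]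
  obtain c where "(\<Sum>i\<in>UNIV. \<Gamma> $ i $ 1 * c $ i) = 1" by blast
  from arg_cong[OF this, of "\<lambda>p. poly p x"] * show False by (simp add: poly_sum)
qed

lemma generators_top_coeff: "\<exists>i. coeff (\<Gamma> $ i $ 1) n \<noteq> 0"
proof (rule ccontr)
  assume *: "\<not> ?thesis"
  have "monom 1 (2 * n - 1) \<in> polys_below (2 * n)"
    using n_pos by (auto simp: polys_below_def)
  from generators_onto[OF this]
  obtain c where c: "c \<in> pbox (\<lambda>_. n)" "(\<Sum>i\<in>UNIV. \<Gamma> $ i $ 1 * c $ i) = monom 1 (2 * n - 1)"
    by blast
  have "\<Gamma> $ i $ 1 \<in> polys_below (Suc (n - 1))" for i
    using deg_gen[of i] * n_pos unfolding polys_below_def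
    by (auto simp: Suc_le_eq) (metis le_neq_implies_less)
  then have "(\<Sum>i\<in>UNIV. c $ i * \<Gamma> $ i $ 1) \<in> polys_below (n + (n - 1))"
    using c(1) by (intro polys_below_sum polys_below_mult) (auto simp: pbox_def)
  then have "coeff (\<Sum>i\<in>UNIV. \<Gamma> $ i $ 1 * c $ i) (2 * n - 1) = 0"
    using n_pos by (simp add: polys_below_def mult.commute)
  then show False unfolding c(2) by simp
qed

text \<open>
  A vector killed by the transpose of \<open>N\<close> is orthogonal to all syzygies of the generators, in
  particular to the Koszul syzygies \<open>g\<^sub>j e\<^sub>i - g\<^sub>i e\<^sub>j\<close>, so it is proportional to the vector of
  generators, and the latter has no common zero.
\<close>

lemma dual_exact:
  assumes x: "x \<in> pbox (\<lambda>_. d)" and xN: "x v* N = 0"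
  shows "\<exists>l\<in>pbox (\<lambda>_. d - n). \<Gamma> *v l = x"
proof -
  have par: "x $ i * \<Gamma> $ j $ 1 = x $ j * \<Gamma> $ i $ 1" for i j
  proof -
    let ?z = "axis i (\<Gamma> $ j $ 1) - axis j (\<Gamma> $ i $ 1)"
    have "?z v* \<Gamma> = 0"
      by (auto simp: vec_eq_iff vector_matrix_mult_def axis_def forall_1 algebra_simps
          sum_subtractf if_distrib[of "\<lambda>t. _ * t"] cong: if_cong)
    moreover have "?z \<in> pbox (\<lambda>_. Suc n)"
      using deg_gen by (auto simp: pbox_def axis_def polys_below_def)
    ultimately obtain y where y: "N *v y = ?z" using exact by blast
    have "(\<Sum>k\<in>UNIV. x $ k * (N *v y) $ k) = (\<Sum>l\<in>UNIV. (x v* N) $ l * y $ l)"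
      by (simp add: matrix_vector_mult_def vector_matrix_mult_def sum_distrib_left sum_distrib_right)
         (subst sum.swap, simp add: mult_ac)
    then have "(\<Sum>k\<in>UNIV. x $ k * ?z $ k) = 0" using xN y by simp
    then show ?thesis
      by (simp add: axis_def algebra_simps sum_subtractf if_distrib[of "\<lambda>t. _ * t"] cong: if_cong)
  qed
  obtain i0 where "coeff (\<Gamma> $ i0 $ 1) n \<noteq> 0" using generators_top_coeff by blast
  then have "\<exists>l\<in>polys_below (d - n). \<forall>i. x $ i = l * (\<chi> i. \<Gamma> $ i $ 1) $ i"
    using x par generators_no_common_root deg_gen
    by (intro parallel_to_base_point_free_vector[where ?i0.0 = i0]) (auto simp: pbox_def)
  then obtain l where "l \<in> polys_below (d - n)" "\<forall>i. x $ i = l * \<Gamma> $ i $ 1" by auto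
  then show ?thesis
    by (intro bexI[of _ "\<chi> _. l"])
       (auto simp: pbox_def matrix_vector_mult_def vec_eq_iff mult.commute)
qed

text \<open>
  The cokernel of the transpose of \<open>N\<close> is dual to \<open>A\<close> modulo the generators, hence of finite
  length. The count gives the degree \<open>n - 1\<close> from which on it vanishes; in the application the
  bound \<open>b \<ge> 2n - 1\<close> ensures that this degree is reached.
\<close>

lemma dual_onto:
  assumes "n \<le> d" and "w \<in> pbox (\<lambda>k. d + \<mu> k)"
  shows "\<exists>x\<in>pbox (\<lambda>_. d). x v* N = w"
proof -
  have "\<exists>x\<in>pbox (\<lambda>_. d). transpose N *v x = w"
  proof (rule matrix_onto_pbox)
    show "transpose N *v x \<in> pbox (\<lambda>k. d + \<mu> k)" if "x \<in> pbox (\<lambda>_. d)" for x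
      using syz_pbox[OF that] by simp
    show "\<exists>l\<in>pbox (\<lambda>_. d - n). \<Gamma> *v l = x"
      if "x \<in> pbox (\<lambda>_. d)" "transpose N *v x = 0" for x
      using dual_exact that by simp
    show "(\<Sum>k\<in>(UNIV::1 set). d - n) + (\<Sum>k\<in>UNIV. d + \<mu> k) \<le> (\<Sum>i\<in>(UNIV :: 'n set). d)"
      using assms(1) by (simp add: sum.distrib sum_mu card_rows)
  qed (rule assms(2))
  then show ?thesis by simp
qed

end

section \<open>Vectors of bivariate polynomials\<close>

text \<open>
  A polynomial in \<open>s\<close> and \<open>u\<close> is a polynomial in the outer variable \<open>s\<close> with coefficients in
  \<open>K[u]\<close>. Matrices over \<open>K[u]\<close> act on each coefficient separately, so statements over \<open>A\<close> extend to
  statements over \<open>R = A[s,t]\<close> slice by slice.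
\<close>

definition slice :: "nat \<Rightarrow> 'a::zero poly poly ^ 'n \<Rightarrow> 'a poly ^ 'n" where
  "slice l x = (\<chi> i. coeff (x $ i) l)"

definition bbox :: "nat \<Rightarrow> ('n \<Rightarrow> nat) \<Rightarrow> ('a::zero poly poly ^ 'n) set" where
  "bbox c m = {x. \<forall>l. slice l x \<in> pbox m \<and> (c \<le> l \<longrightarrow> slice l x = 0)}"

definition cmat :: "'a::zero poly ^ 'n ^ 'm \<Rightarrow> 'a poly poly ^ 'n ^ 'm" where
  "cmat A = (\<chi> i j. [:A $ i $ j:])"

lemma slice_nth [simp]: "slice l x $ i = coeff (x $ i) l"
  by (simp add: slice_def)

lemma cmat_nth [simp]: "cmat A $ i $ j = [:A $ i $ j:]"
  by (simp add: cmat_def)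

lemma transpose_cmat: "transpose (cmat A) = cmat (transpose A)"
  by (simp add: vec_eq_iff transpose_def)

lemma slice_eq_iff: "x = y \<longleftrightarrow> (\<forall>l. slice l x = slice l y)"
  by (auto simp: vec_eq_iff poly_eq_iff)

lemma slice_cmat: "slice l (cmat A *v x) = A *v slice l (x :: 'a::comm_ring_1 poly poly ^ 'n)"
  by (simp add: vec_eq_iff matrix_vector_mult_def coeff_sum)

lemma exists_vector_with_slices:
  assumes "\<And>l. y l \<in> pbox m" and "\<And>l. c \<le> l \<Longrightarrow> y l = 0"
  shows "\<exists>Y\<in>bbox c m. \<forall>l. slice l Y = (y l :: 'a::zero poly ^ 'n)"
proof -
  let ?Y = "\<chi> i. Abs_poly (\<lambda>l. y l $ i)"
  have "coeff (Abs_poly (\<lambda>l. y l $ i)) l = y l $ i" for i l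
    by (subst coeff_Abs_poly[of c]) (use assms(2) in auto)
  then have "slice l ?Y = y l" for l by (simp add: vec_eq_iff)
  then show ?thesis using assms by (intro bexI[of _ ?Y]) (auto simp: bbox_def)
qed

lemma lift_exactness:
  fixes A :: "'a::comm_ring_1 poly ^ 'l ^ 'n"
  assumes ex: "\<And>x. x \<in> pbox m \<Longrightarrow> C *v x = 0 \<Longrightarrow> \<exists>y\<in>pbox k. A *v y = x"
    and X: "X \<in> bbox c m" "cmat C *v X = 0"
  shows "\<exists>Y\<in>bbox c k. cmat A *v Y = X"
proof -
  have "\<exists>y\<in>pbox k. A *v y = slice l X \<and> (c \<le> l \<longrightarrow> y = 0)" for l
  proof (cases "c \<le> l")
    case True
    then show ?thesis using X(1) by (intro bexI[of _ 0]) (auto simp: bbox_def pbox_def)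
  next
    case False
    have "C *v slice l X = slice l (cmat C *v X)" by (simp add: slice_cmat)
    also have "\<dots> = 0" unfolding X(2) by (simp add: vec_eq_iff)
    finally have "C *v slice l X = 0" .
    then show ?thesis using ex X(1) False by (auto simp: bbox_def)
  qed
  then obtain y where y: "\<And>l. y l \<in> pbox k" "\<And>l. A *v y l = slice l X" "\<And>l. c \<le> l \<Longrightarrow> y l = 0"
    by metis
  obtain Y where "Y \<in> bbox c k" "\<And>l. slice l Y = y l"
    using exists_vector_with_slices[of y k c] y by blast
  then show ?thesis using y(2) by (intro bexI[of _ Y]) (auto simp: slice_eq_iff slice_cmat)
qed

text \<open>
  Restriction to the line on which the inner variable has the value \<open>y\<close>.
\<close>
definition eval_inner :: "'a::comm_ring_1 \<Rightarrow> 'a poly poly \<Rightarrow> 'a poly" where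
  "eval_inner y p = map_poly (\<lambda>q. poly q y) p"

lemma coeff_eval_inner [simp]: "coeff (eval_inner y p) l = poly (coeff p l) y"
  by (simp add: eval_inner_def coeff_map_poly)

lemma eval_inner_mult: "eval_inner y (p * q) = eval_inner y p * eval_inner y q"
  by (simp add: poly_eq_iff coeff_mult poly_sum)

lemma poly_eval_inner: "poly (eval_inner y p) x = poly (poly p [:x:]) y"
proof (induction p)
  case 0
  then show ?case by (simp add: eval_inner_def)
next
  case (pCons c p)
  have "eval_inner y (pCons c p) = pCons (poly c y) (eval_inner y p)"
    by (auto simp: poly_eq_iff coeff_pCons split: nat.splits)
  then show ?case using pCons by simp
qed

lemma eval_inner_all_0:
  fixes p :: "'a::alg_closed_field poly poly"
  assumes "\<And>y. eval_inner y p = 0"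
  shows "p = 0"
proof -
  have "poly (coeff p l) y = 0" for l y using assms[of y] by (metis coeff_eval_inner coeff_0)
  then have "coeff p l = 0" for l
    using poly_roots_finite[of "coeff p l"] infinite_UNIV_alg_closed[where ?'a = 'a] by auto
  then show ?thesis by (simp add: poly_eq_iff)
qed


section \<open>Syzygies from the Koszul complex\<close>

text \<open>
  The three Koszul syzygies of a vector of length three: \<open>koszul3 h k\<close> is the cross product of
  \<open>h\<close> with a unit vector, with the sign making its entry number \<open>k + 1\<close> (cyclically) equal to
  \<open>h\<^bsub>k+2\<^esub>\<close>.
\<close>
definition koszul3 :: "'a::comm_ring_1 ^ 3 \<Rightarrow> 3 \<Rightarrow> 'a ^ 3" where
  "koszul3 h k = (if k = 1 then vector [0, h $ 3, - h $ 2]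
     else if k = 2 then vector [- h $ 3, 0, h $ 1] else vector [h $ 2, - h $ 1, 0])"

lemma koszul3_orthogonal: "(\<Sum>j\<in>UNIV. koszul3 h k $ j * h $ j) = 0"
  by (simp add: koszul3_def sum_3)

text \<open>
  A relation among the Koszul syzygies says that the cross product of \<open>r\<close> and \<open>h\<close> is zero.
\<close>

lemma koszul3_relation_parallel:
  assumes "\<And>j. (\<Sum>k\<in>UNIV. r $ k * koszul3 h k $ j) = 0"
  shows "r $ i * h $ j = r $ j * h $ i"
proof -
  have "\<forall>i j. r $ i * h $ j = r $ j * h $ i"
    using assms[of 1] assms[of 2] assms[of 3]
    by (auto simp: forall_3 koszul3_def sum_3 algebra_simps)
  then show ?thesis by blast
qed

text \<open>
  The heart of the matter. Since \<open>f\<close> is a syzygy of the generators, \<open>f = N h\<close>. A column \<open>T\<close> is a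
  syzygy of \<open>f\<close> iff its image under the transpose of \<open>N\<close> is a syzygy of \<open>h\<close>, and the three
  Koszul syzygies of \<open>h\<close> do lift, because their degrees are in the range of \<open>dual_onto\<close>.

  For the independence, apply the transpose of \<open>N\<close> to a relation: the term with \<open>\<Gamma>\<close> disappears
  and a relation \<open>r\<close> of the Koszul syzygies remains, so \<open>r\<close> is proportional to \<open>h\<close>. On every line
  \<open>u = y\<close> the vector \<open>h\<close> has degree \<open>a\<close> and no zero, because a zero of \<open>h\<close> is a zero of \<open>f\<close>,
  whereas \<open>r\<close> has degree less than \<open>a\<close>. So \<open>r\<close> vanishes on each of these lines.
\<close>

lemma syzygies_from_koszul:
  fixes N :: "'a::alg_closed_field poly ^ 3 ^ 'n" and f :: "'a poly poly ^ 'n"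
  assumes "hilbert_burch \<Gamma> N \<mu> n"
    and f: "f \<in> bbox (Suc a) (\<lambda>_. Suc b)" "f v* cmat \<Gamma> = 0" and b: "2 * n \<le> Suc b"
    and nz: "\<And>x y. \<exists>i. poly (poly (f $ i) [:x:]) y \<noteq> 0" "\<And>y. \<exists>i. poly (coeff (f $ i) a) y \<noteq> 0"
  shows "\<exists>T. (\<forall>k. T k \<in> bbox (Suc a) (\<lambda>_. Suc (b - n + \<mu> k)) \<and> (\<Sum>i\<in>UNIV. f $ i * T k $ i) = 0) \<and>
    (\<forall>l r. (\<forall>k. r $ k \<in> polys_below a) \<longrightarrow>
       (\<forall>i. l * [:\<Gamma> $ i $ 1:] + (\<Sum>k\<in>UNIV. r $ k * T k $ i) = 0) \<longrightarrow> l = 0 \<and> r = 0)"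
proof -
  interpret hilbert_burch \<Gamma> N \<mu> n by fact
  have nb: "n \<le> b" using b n_pos by linarith
  have musum: "\<mu> 1 + \<mu> 2 + \<mu> 3 = n" using sum_mu by (simp add: sum_3)
  obtain h where h: "h \<in> bbox (Suc a) (\<lambda>k. Suc b - \<mu> k)" "cmat N *v h = f"
    using lift_exactness[of "\<lambda>_. Suc b" "transpose \<Gamma>" "\<lambda>k. Suc b - \<mu> k" N f "Suc a"] exact f
    by (auto simp: transpose_cmat[symmetric])
  have "koszul3 h k \<in> bbox (Suc a) (\<lambda>j. Suc (b - n + \<mu> k) + \<mu> j)" for k
  proof -
    \<comment> \<open>The entry of \<open>koszul3 h k\<close> at \<open>j \<noteq> k\<close> is, up to sign, the entry of \<open>h\<close> at the remaining
      index, and the three \<open>\<mu>\<close> add up to \<open>n\<close>; this is where the bidegrees of the syzygies come from.\<close>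
    have "Suc b - \<mu> 1 = Suc (b - n + \<mu> 2) + \<mu> 3" "Suc b - \<mu> 2 = Suc (b - n + \<mu> 1) + \<mu> 3"
      "Suc b - \<mu> 3 = Suc (b - n + \<mu> 1) + \<mu> 2"
      using musum nb by auto
    then have "\<forall>k. koszul3 h k \<in> bbox (Suc a) (\<lambda>j. Suc (b - n + \<mu> k) + \<mu> j)"
      using h(1) by (simp add: bbox_def pbox_def koszul3_def forall_3 vec_eq_iff polys_below_uminus add_ac)
    then show ?thesis by blast
  qed
  then have "\<exists>T\<in>bbox (Suc a) (\<lambda>_. Suc (b - n + \<mu> k)). cmat (transpose N) *v T = koszul3 h k" for k
  proof -
    have "n \<le> Suc (b - n + \<mu> k)" using b by linarith
    then have "\<exists>x\<in>pbox (\<lambda>_. Suc (b - n + \<mu> k)). transpose N *v x = w"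
      if "w \<in> pbox (\<lambda>j. Suc (b - n + \<mu> k) + \<mu> j)" for w
      using dual_onto that by simp
    moreover have "cmat (0 :: 'a poly ^ 3 ^ 3) *v koszul3 h k = 0"
      by (simp add: vec_eq_iff matrix_vector_mult_def)
    ultimately show ?thesis
      using lift_exactness[where C = "0 :: 'a poly ^ 3 ^ 3"] \<open>\<And>k. koszul3 h k \<in> _\<close> by blast
  qed
  then obtain T where T: "\<And>k. T k \<in> bbox (Suc a) (\<lambda>_. Suc (b - n + \<mu> k))"
    "\<And>k. T k v* cmat N = koszul3 h k"
    unfolding transpose_cmat[symmetric] transpose_matrix_vector by metis
  have syz: "(\<Sum>i\<in>UNIV. f $ i * T k $ i) = 0" for k
  proof -
    have "(\<Sum>i\<in>UNIV. f $ i * T k $ i) = (\<Sum>j\<in>UNIV. (T k v* cmat N) $ j * h $ j)"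
      unfolding h(2)[symmetric]
      by (simp add: matrix_vector_mult_def vector_matrix_mult_def sum_distrib_left sum_distrib_right
          del: cmat_nth)
         (subst sum.swap, simp add: mult_ac)
    then show ?thesis by (simp add: T(2) koszul3_orthogonal)
  qed
  have indep: "l = 0 \<and> r = 0"
    if r: "\<forall>k. r $ k \<in> polys_below a"
      and rel: "\<forall>i. l * [:\<Gamma> $ i $ 1:] + (\<Sum>k\<in>UNIV. r $ k * T k $ i) = 0" for l r
  proof -
    have \<Gamma>N: "(\<Sum>i\<in>UNIV. \<Gamma> $ i $ 1 * N $ i $ j) = 0" for j
      using complex[of "axis j 1"]
      by (simp add: vec_eq_iff vector_matrix_mult_def matrix_vector_mult_def axis_def mult.commute
          if_distrib[of "\<lambda>t. _ * t"] cong: if_cong)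
    have rel': "(\<Sum>k\<in>UNIV. r $ k * T k $ i) = - (l * [:\<Gamma> $ i $ 1:])" for i
      by (rule minus_unique[OF rel[rule_format], symmetric])
    have "(\<Sum>k\<in>UNIV. r $ k * koszul3 h k $ j) = 0" for j
    proof -
      have "(\<Sum>k\<in>UNIV. r $ k * koszul3 h k $ j)
        = (\<Sum>i\<in>UNIV. (\<Sum>k\<in>UNIV. r $ k * T k $ i) * [:N $ i $ j:])"
        unfolding T(2)[symmetric]
        by (simp only: vector_matrix_mult_def sum_distrib_left sum_distrib_right vec_lambda_beta cmat_nth)
           (subst sum.swap, simp only: mult_ac)
      also have "\<dots> = (\<Sum>i\<in>UNIV. - (l * [:\<Gamma> $ i $ 1:]) * [:N $ i $ j:])"
        by (simp only: rel')
      also have "\<dots> = - l * [:\<Sum>i\<in>UNIV. \<Gamma> $ i $ 1 * N $ i $ j:]"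
        by (simp add: poly_eq_iff coeff_sum sum_distrib_left sum_negf coeff_pCons mult_ac split: nat.splits)
      finally show ?thesis by (simp add: \<Gamma>N)
    qed
    then have par: "r $ i * h $ j = r $ j * h $ i" for i j
      by (rule koszul3_relation_parallel)
    have ev: "eval_inner y (r $ k) = 0" for y k
    proof -
      let ?h = "\<chi> k. eval_inner y (h $ k)" and ?r = "\<chi> k. eval_inner y (r $ k)"
      have fh: "f $ i = (\<Sum>k\<in>UNIV. [:N $ i $ k:] * h $ k)" for i
        using h(2) by (auto simp: matrix_vector_mult_def)
      obtain k0 where k0: "coeff (?h $ k0) a \<noteq> 0"
        using nz(2)[of y] unfolding fh by (force simp: coeff_sum poly_sum)
      have "\<exists>l\<in>polys_below (a - a). \<forall>i. ?r $ i = l * ?h $ i"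
      proof (rule parallel_to_base_point_free_vector[OF _ _ _ k0])
        show "?r $ i * ?h $ j = ?r $ j * ?h $ i" for i j
          using par[of i j] by (simp flip: eval_inner_mult)
        show "\<exists>j. poly (?h $ j) x \<noteq> 0" for x
        proof (rule ccontr)
          assume "\<not> ?thesis"
          then have "poly (poly (f $ i) [:x:]) y = 0" for i
            unfolding fh by (simp add: poly_sum poly_eval_inner)
          then show False using nz(1)[of x y] by blast
        qed
        show "?h $ i \<in> polys_below (Suc a)" for i
          using h(1) by (simp add: polys_below_def bbox_def vec_eq_iff)
        show "?r $ i \<in> polys_below a" for i
          using r by (simp add: polys_below_def)
      qed
      then show ?thesis by auto
    qed
    have r0: "r = 0" using eval_inner_all_0[OF ev] by (simp add: vec_eq_iff)
    moreover obtain i where i: "\<Gamma> $ i $ 1 \<noteq> 0" using generators_top_coeff by force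
    have "l * [:\<Gamma> $ i $ 1:] = 0" 
      using rel[rule_format, of i] by (simp only: r0 zero_index mult_zero_left sum.neutral_const add_0_right)
    then have "l = 0 \<or> [:\<Gamma> $ i $ 1:] = 0" by (simp only: mult_eq_0_iff)
    then have "l = 0" using i by (simp only: pCons_eq_0_iff simp_thms)
    ultimately show ?thesis by blast
  qed
  show ?thesis
    by (rule exI[of _ T], intro conjI allI impI) (use T(1) syz indep in blast)+
qed

section \<open>Dehomogenisation\<close>

definition mono4 :: "nat \<Rightarrow> nat \<Rightarrow> nat \<Rightarrow> nat \<Rightarrow> monom4" where
  "mono4 i i' j j' = Poly_Mapping.single Var_s i + Poly_Mapping.single Var_t i' + uv_monom j j'"

lemma lookup_mono4 [simp]:
  "Poly_Mapping.lookup (mono4 i i' j j') Var_s = i" "Poly_Mapping.lookup (mono4 i i' j j') Var_t = i'"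
  "Poly_Mapping.lookup (mono4 i i' j j') Var_u = j" "Poly_Mapping.lookup (mono4 i i' j j') Var_v = j'"
  by (simp_all add: mono4_def uv_monom_def lookup_add lookup_single)

lemma monom4_eq_iff:
  "m = m' \<longleftrightarrow> Poly_Mapping.lookup m Var_s = Poly_Mapping.lookup m' Var_s \<and> Poly_Mapping.lookup m Var_t = Poly_Mapping.lookup m' Var_t \<and>
     Poly_Mapping.lookup m Var_u = Poly_Mapping.lookup m' Var_u \<and> Poly_Mapping.lookup m Var_v = Poly_Mapping.lookup m' Var_v" (is "_ \<longleftrightarrow> ?rhs")
  for m :: monom4
proof
  assume *: "?rhs"
  show "m = m'"
  proof (rule poly_mapping_eqI)
    fix x show "Poly_Mapping.lookup m x = Poly_Mapping.lookup m' x" using * by (cases x) auto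
  qed
qed auto

definition has_bidegree :: "nat \<Rightarrow> nat \<Rightarrow> monom4 \<Rightarrow> bool" where
  "has_bidegree c d m \<longleftrightarrow> Poly_Mapping.lookup m Var_s + Poly_Mapping.lookup m Var_t = c \<and> Poly_Mapping.lookup m Var_u + Poly_Mapping.lookup m Var_v = d"

lemma has_bidegree_mono4: "i \<le> c \<Longrightarrow> j \<le> d \<Longrightarrow> has_bidegree c d (mono4 i (c - i) j (d - j))"
  by (simp add: has_bidegree_def)

lemma has_bidegree_cases:
  assumes "has_bidegree c d m"
  obtains i j where "i \<le> c" "j \<le> d" "m = mono4 i (c - i) j (d - j)"
  using assms that[of "Poly_Mapping.lookup m Var_s" "Poly_Mapping.lookup m Var_u"]
  by (auto simp: has_bidegree_def monom4_eq_iff)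

lemma bihom_iff: "p \<in> bihom c d \<longleftrightarrow> (\<forall>m\<in>Poly_Mapping.keys p. has_bidegree c d m)"
  by (simp add: bihom_def has_bidegree_def)

lemma bihom_iff_lookup: "p \<in> bihom c d \<longleftrightarrow> (\<forall>m. \<not> has_bidegree c d m \<longrightarrow> Poly_Mapping.lookup p m = 0)"
  by (auto simp: bihom_iff in_keys_iff)

lemma bihom_0 [simp]: "0 \<in> bihom c d"
  by (simp add: bihom_iff)

lemma bihom_add: "p \<in> bihom c d \<Longrightarrow> q \<in> bihom c d \<Longrightarrow> p + q \<in> bihom c d"
  by (auto simp: bihom_iff_lookup lookup_add)

lemma bihom_sum: "(\<And>i. i \<in> A \<Longrightarrow> f i \<in> bihom c d) \<Longrightarrow> sum f A \<in> bihom c d"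
  by (induction A rule: infinite_finite_induct) (auto intro: bihom_add)

lemma has_bidegree_add:
  "has_bidegree c d m \<Longrightarrow> has_bidegree c' d' m' \<Longrightarrow> has_bidegree (c + c') (d + d') (m + m')"
  by (auto simp: has_bidegree_def lookup_add)

lemma bihom_mult:
  "p \<in> bihom c d \<Longrightarrow> q \<in> bihom c' d' \<Longrightarrow> p * q \<in> bihom (c + c') (d + d')"
  using keys_mult[of p q] by (fastforce simp: bihom_iff intro: has_bidegree_add)

lemma Const_bihom: "Const c \<in> bihom 0 0"
  by (auto simp: bihom_iff Const_def has_bidegree_def split: if_splits)

lemma Const_mult_bihom: "p \<in> bihom c d \<Longrightarrow> Const k * p \<in> bihom c d"
  using bihom_mult[OF Const_bihom, of p c d k] by simp

lemma bihom_subset_ring_A: "bihom 0 d \<subseteq> ring_A"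
  by (auto simp: bihom_def ring_A_def)

definition bihom_of_coeffs :: "nat \<Rightarrow> nat \<Rightarrow> (nat \<Rightarrow> nat \<Rightarrow> 'a) \<Rightarrow> 'a::comm_ring_1 poly4" where
  "bihom_of_coeffs c d \<phi> =
     (\<Sum>i\<le>c. \<Sum>j\<le>d. Poly_Mapping.single (mono4 i (c - i) j (d - j)) (\<phi> i j))"

lemma bihom_of_coeffs_bihom: "bihom_of_coeffs c d \<phi> \<in> bihom c d"
  unfolding bihom_of_coeffs_def
  by (intro bihom_sum) (auto simp: bihom_iff has_bidegree_mono4 split: if_splits)

lemma lookup_bihom_of_coeffs:
  assumes "i \<le> c" "j \<le> d"
  shows "Poly_Mapping.lookup (bihom_of_coeffs c d \<phi>) (mono4 i (c - i) j (d - j)) = \<phi> i j"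
proof -
  have "Poly_Mapping.lookup (bihom_of_coeffs c d \<phi>) (mono4 i (c - i) j (d - j))
      = (\<Sum>i'\<le>c. \<Sum>j'\<le>d. if i' = i then if j' = j then \<phi> i j else 0 else 0)"
    unfolding bihom_of_coeffs_def lookup_sum
    by (intro sum.cong refl) (auto simp: lookup_single when_def monom4_eq_iff)
  also have "\<dots> = (\<Sum>i'\<le>c. if i' = i then (\<Sum>j'\<le>d. if j' = j then \<phi> i j else 0) else 0)"
    by (intro sum.cong refl) auto
  also have "\<dots> = \<phi> i j" using assms by simp
  finally show ?thesis .
qed

lemma bihom_eqI:
  assumes "p \<in> bihom c d" "q \<in> bihom c d"
    and "\<And>i j. i \<le> c \<Longrightarrow> j \<le> d \<Longrightarrow>
      Poly_Mapping.lookup p (mono4 i (c - i) j (d - j)) = Poly_Mapping.lookup q (mono4 i (c - i) j (d - j))"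
  shows "p = q"
proof (rule poly_mapping_eqI)
  fix m show "Poly_Mapping.lookup p m = Poly_Mapping.lookup q m"
  proof (cases "has_bidegree c d m")
    case True
    then show ?thesis by (rule has_bidegree_cases) (use assms(3) in auto)
  qed (use assms(1,2) in \<open>auto simp: bihom_iff_lookup\<close>)
qed

lemma bihom_expand:
  "p \<in> bihom c d \<Longrightarrow> p = bihom_of_coeffs c d (\<lambda>i j. Poly_Mapping.lookup p (mono4 i (c - i) j (d - j)))"
  by (rule bihom_eqI) (auto simp: bihom_of_coeffs_bihom lookup_bihom_of_coeffs)

text \<open>
  The substitution \<open>t = v = 1\<close>, with \<open>s\<close> as outer and \<open>u\<close> as inner variable. It is a ring
  homomorphism that is injective on each bihomogeneous component.
\<close>
definition dehom :: "'a::comm_ring_1 poly4 \<Rightarrow> 'a poly poly" where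
  "dehom p = (\<Sum>m\<in>Poly_Mapping.keys p. monom (monom (Poly_Mapping.lookup p m) (Poly_Mapping.lookup m Var_u)) (Poly_Mapping.lookup m Var_s))"

lemma dehom_superset:
  assumes "finite A" "Poly_Mapping.keys p \<subseteq> A"
  shows "dehom p = (\<Sum>m\<in>A. monom (monom (Poly_Mapping.lookup p m) (Poly_Mapping.lookup m Var_u)) (Poly_Mapping.lookup m Var_s))"
  unfolding dehom_def using assms by (intro sum.mono_neutral_left) (auto simp: in_keys_iff)

lemma dehom_0 [simp]: "dehom 0 = 0"
  by (simp add: dehom_def)

lemma dehom_add: "dehom (p + q) = dehom p + dehom q"
proof -
  let ?A = "Poly_Mapping.keys p \<union> Poly_Mapping.keys q"
  have "Poly_Mapping.keys (p + q) \<subseteq> ?A" by (rule keys_add)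
  then show ?thesis
    by (simp add: dehom_superset[of ?A] lookup_add sum.distrib flip: add_monom)
qed

lemma dehom_sum: "dehom (sum f A) = (\<Sum>i\<in>A. dehom (f i))"
  by (induction A rule: infinite_finite_induct) (auto simp: dehom_add)

lemma dehom_single:
  "dehom (Poly_Mapping.single m c) = monom (monom c (Poly_Mapping.lookup m Var_u)) (Poly_Mapping.lookup m Var_s)"
  by (simp add: dehom_def)

lemma dehom_Const: "dehom (Const c) = [:[:c:]:]"
  by (simp add: Const_def dehom_single monom_0)

lemma poly_mapping_eq_sum_single:
  "p = (\<Sum>m\<in>Poly_Mapping.keys p. Poly_Mapping.single m (Poly_Mapping.lookup p m))" for p :: "'b \<Rightarrow>\<^sub>0 'a::comm_monoid_add"
  by (rule poly_mapping_eqI) (simp add: lookup_sum lookup_single when_def in_keys_iff)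

lemma dehom_mult: "dehom (p * q) = dehom p * dehom q"
proof -
  have single: "dehom (Poly_Mapping.single m c * Poly_Mapping.single m' c')
      = dehom (Poly_Mapping.single m c) * dehom (Poly_Mapping.single m' c')"
    for m m' and c c' :: 'a
    by (simp add: mult_single dehom_single mult_monom lookup_add)
  have "dehom (p * q) = dehom ((\<Sum>m\<in>Poly_Mapping.keys p. Poly_Mapping.single m (Poly_Mapping.lookup p m)) *
      (\<Sum>m\<in>Poly_Mapping.keys q. Poly_Mapping.single m (Poly_Mapping.lookup q m)))"
    by (simp flip: poly_mapping_eq_sum_single)
  also have "\<dots> = dehom (\<Sum>m\<in>Poly_Mapping.keys p. Poly_Mapping.single m (Poly_Mapping.lookup p m)) *
      dehom (\<Sum>m\<in>Poly_Mapping.keys q. Poly_Mapping.single m (Poly_Mapping.lookup q m))"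
    by (simp add: sum_product dehom_sum single)
  finally show ?thesis by (simp flip: poly_mapping_eq_sum_single)
qed

lemma coeff_dehom:
  assumes "p \<in> bihom c d"
  shows "coeff (coeff (dehom p) i) j
    = (if i \<le> c \<and> j \<le> d then Poly_Mapping.lookup p (mono4 i (c - i) j (d - j)) else 0)"
proof -
  have "coeff (coeff (dehom p) i) j
      = (\<Sum>m\<in>Poly_Mapping.keys p. if m = mono4 i (c - i) j (d - j) \<and> i \<le> c \<and> j \<le> d then Poly_Mapping.lookup p m else 0)"
    unfolding dehom_def coeff_sum using assms
    by (intro sum.cong refl) (auto simp: bihom_def monom4_eq_iff)
  also have "\<dots> = (if i \<le> c \<and> j \<le> d then Poly_Mapping.lookup p (mono4 i (c - i) j (d - j)) else 0)"
    by (auto simp: in_keys_iff)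
  finally show ?thesis .
qed

lemma dehom_inj:
  assumes "p \<in> bihom c d" "q \<in> bihom c d" "dehom p = dehom q"
  shows "p = q"
  using assms(1,2) by (rule bihom_eqI) (metis assms coeff_dehom)

lemma dehom_eq_0: "p \<in> bihom c d \<Longrightarrow> dehom p = 0 \<Longrightarrow> p = 0"
  using dehom_inj[of p c d 0] by simp

lemma coeff_dehom_polys_below: "p \<in> bihom c d \<Longrightarrow> coeff (dehom p) i \<in> polys_below (Suc d)"
  by (simp add: polys_below_def coeff_dehom)

lemma dehom_polys_below: "p \<in> bihom c d \<Longrightarrow> dehom p \<in> polys_below (Suc c)"
  by (simp add: polys_below_def poly_eq_iff coeff_dehom)

lemma dehom_bihom_0: "p \<in> bihom 0 d \<Longrightarrow> dehom p = [:coeff (dehom p) 0:]"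
  by (auto simp: poly_eq_iff coeff_pCons coeff_dehom split: nat.splits)

definition homog :: "nat \<Rightarrow> nat \<Rightarrow> 'a::comm_ring_1 poly poly \<Rightarrow> 'a poly4" where
  "homog c d P = bihom_of_coeffs c d (\<lambda>i j. coeff (coeff P i) j)"

lemma homog_bihom: "homog c d P \<in> bihom c d"
  by (simp add: homog_def bihom_of_coeffs_bihom)

lemma dehom_homog:
  assumes "P \<in> polys_below (Suc c)" "\<And>i. coeff P i \<in> polys_below (Suc d)"
  shows "dehom (homog c d P) = P"
  unfolding poly_eq_iff homog_def coeff_dehom[OF bihom_of_coeffs_bihom]
  using assms by (auto simp: lookup_bihom_of_coeffs polys_below_def not_le Suc_le_eq)

lemma poly4_eval_affine:
  assumes "x Var_t = 1" "x Var_v = 1"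
  shows "poly4_eval x p = poly (poly (dehom p) [:x Var_s:]) (x Var_u)"
  by (simp add: poly4_eval_def dehom_def poly_sum poly_monom assms mult_ac)

text \<open>
  At the point \<open>(1 : 0)\<close> of the first line only the monomials without \<open>t\<close> survive, and these form
  the coefficient of the highest possible power of \<open>s\<close>.
\<close>

lemma poly4_eval_infinity:
  assumes "p \<in> bihom c d" "x Var_s = 1" "x Var_t = 0" "x Var_v = 1"
  shows "poly4_eval x p = poly (coeff (dehom p) c) (x Var_u)"
  unfolding poly4_eval_def dehom_def coeff_sum poly_sum
  using assms by (intro sum.cong refl) (auto simp: bihom_def poly_monom power_0_left)


section \<open>Bihomogeneous components\<close>

definition bicomp :: "nat \<Rightarrow> nat \<Rightarrow> 'a::zero poly4 \<Rightarrow> 'a poly4" where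
  "bicomp c d p = Poly_Mapping.mapp (\<lambda>m x. x when has_bidegree c d m) p"

lemma lookup_bicomp: "Poly_Mapping.lookup (bicomp c d p) m = (Poly_Mapping.lookup p m when has_bidegree c d m)"
  by (auto simp: bicomp_def lookup_mapp when_def in_keys_iff)

lemma bicomp_bihom: "bicomp c d p \<in> bihom c d"
  by (simp add: bihom_iff_lookup lookup_bicomp)

lemma bicomp_id: "p \<in> bihom c d \<Longrightarrow> bicomp c d p = p"
  by (rule poly_mapping_eqI) (auto simp: bihom_iff_lookup lookup_bicomp when_def)

lemma bicomp_add: "bicomp c d (p + q) = bicomp c d p + bicomp c d q"
  by (rule poly_mapping_eqI) (auto simp: lookup_bicomp lookup_add when_def)

lemma bicomp_sum: "bicomp c d (sum f A) = (\<Sum>i\<in>A. bicomp c d (f i))"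
  by (rule poly_mapping_eqI) (auto simp: lookup_bicomp lookup_sum when_def)

text \<open>
  For a homogeneous factor \<open>p\<close>, taking components commutes with multiplication by \<open>p\<close>. Thus
  coefficients in a homogeneous equation can always be replaced by homogeneous ones.
\<close>

lemma bicomp_mult:
  fixes p q :: "'a::comm_ring_1 poly4"
  assumes p: "p \<in> bihom c d"
  shows "bicomp C D (q * p) = (if c \<le> C \<and> d \<le> D then bicomp (C - c) (D - d) q * p else 0)"
proof -
  let ?q = "if c \<le> C \<and> d \<le> D then bicomp (C - c) (D - d) q else 0"
  have key: "\<not> (c \<le> C \<and> d \<le> D \<and> has_bidegree (C - c) (D - d) m)" if "m \<in> Poly_Mapping.keys (q - ?q)" for m
    using that by (auto simp: in_keys_iff lookup_minus lookup_bicomp when_def split: if_splits)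
  have "bicomp C D ((q - ?q) * p) = 0"
  proof (rule poly_mapping_eqI)
    fix m
    have "\<not> has_bidegree C D m" if mk: "m \<in> Poly_Mapping.keys ((q - ?q) * p)"
    proof
      assume m: "has_bidegree C D m"
      obtain m1 m2 where "m = m1 + m2" "m1 \<in> Poly_Mapping.keys (q - ?q)" "m2 \<in> Poly_Mapping.keys p"
        using keys_mult[of "q - ?q" p] mk by blast
      then show False using key[of m1] p m by (auto simp: bihom_def has_bidegree_def lookup_add)
    qed
    then show "Poly_Mapping.lookup (bicomp C D ((q - ?q) * p)) m = Poly_Mapping.lookup 0 m"
      unfolding in_keys_iff lookup_bicomp when_def by (metis lookup_zero)
  qed
  moreover have "bicomp C D (?q * p) = ?q * p"
  proof (cases "c \<le> C \<and> d \<le> D")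
    case True
    then show ?thesis
      using bihom_mult[OF bicomp_bihom p, of "C - c" "D - d" q] by (auto intro: bicomp_id)
  next
    case False
    then show ?thesis by (auto simp: bicomp_id)
  qed
  moreover have "bicomp C D (q * p) = bicomp C D ((q - ?q) * p) + bicomp C D (?q * p)"
    by (simp only: distrib_right[symmetric] diff_add_cancel flip: bicomp_add)
  ultimately show ?thesis by auto
qed

text \<open>
  If the homogeneous columns \<open>S k\<close> have no relation in bidegree \<open>(C, D)\<close>, then the component of
  their \<open>R\<close>-span there is the direct sum of shifted components of \<open>R\<close>, and the products of the
  \<open>S k\<close> with monomials form a basis.
\<close>

lemma dim_span_bihom_component:
  fixes S :: "'i::finite \<Rightarrow> 'a::field poly4 ^ 'n"
  assumes S: "\<And>k. S k \<in> bihom_col (c k) (d k)" and le: "\<And>k. c k \<le> C" "\<And>k. d k \<le> D"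
    and indep: "\<And>q. (\<And>k. q k \<in> bihom (C - c k) (D - d k)) \<Longrightarrow> (\<Sum>k\<in>UNIV. q k *s S k) = 0 \<Longrightarrow>
      \<forall>k. q k = 0"
  shows "K_col.dim (R_col.span (range S) \<inter> bihom_col C D)
    = (\<Sum>k\<in>UNIV. Suc (C - c k) * Suc (D - d k))"
proof -
  define I where "I = (SIGMA k:(UNIV :: 'i set). {..C - c k} \<times> {..D - d k})"
  define e where "e = (\<lambda>(k, i, j).
    Poly_Mapping.single (mono4 i (C - c k - i) j (D - d k - j)) (1 :: 'a) *s S k)"
  have fin: "finite I" by (simp add: I_def)
  have comb: "(\<Sum>x\<in>I. smult_col_K (\<phi> x) (e x))
    = (\<Sum>k\<in>UNIV. bihom_of_coeffs (C - c k) (D - d k) (\<lambda>i j. \<phi> (k, i, j)) *s S k)" for \<phi>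
  proof -
    have "(\<Sum>x\<in>I. smult_col_K (\<phi> x) (e x)) = (\<Sum>k\<in>UNIV. \<Sum>i\<le>C - c k. \<Sum>j\<le>D - d k.
        smult_col_K (\<phi> (k, i, j)) (e (k, i, j)))"
      by (simp add: I_def sum.Sigma sum.cartesian_product case_prod_unfold)
    also have "\<dots> = (\<Sum>k\<in>UNIV. \<Sum>i\<le>C - c k. \<Sum>j\<le>D - d k.
        Poly_Mapping.single (mono4 i (C - c k - i) j (D - d k - j)) (\<phi> (k, i, j)) *s S k)"
      by (simp add: e_def smult_col_K_def Const_def vec_eq_iff mult_single flip: mult.assoc)
    finally show ?thesis by (simp add: bihom_of_coeffs_def R_col.scale_sum_left)
  qed
  have "R_col.span (range S) \<inter> bihom_col C D = K_col.span (e ` I)"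
  proof (intro equalityI subsetI)
    fix x assume x: "x \<in> R_col.span (range S) \<inter> bihom_col C D"
    have "\<exists>q. x = (\<Sum>k\<in>UNIV. q k *s S k)"
      using IntD1[OF x]
    proof (induction rule: R_col.span_induct_alt)
      case base
      then show ?case by (intro exI[of _ "\<lambda>_. 0"]) simp
    next
      case (step r y z)
      then obtain k0 q where "y = S k0" "z = (\<Sum>k\<in>UNIV. q k *s S k)" by auto
      moreover have "(\<Sum>k\<in>UNIV. (if k = k0 then r else 0) *s S k) = r *s S k0"
        by (simp add: if_distrib[of "\<lambda>t. t *s _"] cong: if_cong)
      ultimately show ?case
        by (intro exI[of _ "\<lambda>k. (if k = k0 then r else 0) + q k"])
           (simp add: R_col.scale_left_distrib sum.distrib)
    qed
    then obtain q where q: "x = (\<Sum>k\<in>UNIV. q k *s S k)" by blast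
    have "x $ i = (\<Sum>k\<in>UNIV. bicomp (C - c k) (D - d k) (q k) * S k $ i)" for i
    proof -
      have "x $ i = bicomp C D (x $ i)" using IntD2[OF x] by (simp add: bicomp_id bihom_col_def)
      also have "\<dots> = (\<Sum>k\<in>UNIV. bicomp C D (q k * S k $ i))" by (simp add: q bicomp_sum)
      also have "\<dots> = (\<Sum>k\<in>UNIV. bicomp (C - c k) (D - d k) (q k) * S k $ i)"
      proof (rule sum.cong[OF refl])
        fix k
        have "S k $ i \<in> bihom (c k) (d k)" using S by (simp add: bihom_col_def)
        from bicomp_mult[OF this, of C D "q k"] le
        show "bicomp C D (q k * S k $ i) = bicomp (C - c k) (D - d k) (q k) * S k $ i" by simp
      qed
      finally show ?thesis .
    qed
    then have "x = (\<Sum>k\<in>UNIV. bicomp (C - c k) (D - d k) (q k) *s S k)"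
      by (simp add: vec_eq_iff)
    also have "\<dots> = (\<Sum>x\<in>I. smult_col_K ((\<lambda>(k, i, j). Poly_Mapping.lookup (bicomp (C - c k) (D - d k) (q k))
        (mono4 i (C - c k - i) j (D - d k - j))) x) (e x))"
      unfolding comb by (simp only: prod.case flip: bihom_expand[OF bicomp_bihom])
    also have "\<dots> \<in> K_col.span (e ` I)"
      by (intro K_col.span_sum K_col.span_scale K_col.span_base imageI)
    finally show "x \<in> K_col.span (e ` I)" .
  next
    fix x assume "x \<in> K_col.span (e ` I)"
    then show "x \<in> R_col.span (range S) \<inter> bihom_col C D"
    proof (induction rule: K_col.span_induct_alt)
      case base
      then show ?case by (simp add: R_col.span_zero bihom_col_def)
    next
      case (step r y z)
      then obtain k i j where kij: "i \<le> C - c k" "j \<le> D - d k" "y = e (k, i, j)"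
        by (auto simp: I_def)
      let ?p = "Poly_Mapping.single (mono4 i (C - c k - i) j (D - d k - j)) (1 :: 'a)"
      have p: "?p \<in> bihom (C - c k) (D - d k)"
        using has_bidegree_mono4[OF kij(1,2)] by (simp add: bihom_iff del: diff_diff_left)
      have "?p * S k $ l \<in> bihom C D" for l
        using bihom_mult[OF p, of "S k $ l" "c k" "d k"] S[of k] le[of k]
        by (simp add: bihom_col_def del: diff_diff_left)
      then have "y \<in> bihom_col C D" by (simp add: kij(3) e_def bihom_col_def del: diff_diff_left)
      then have "smult_col_K r y \<in> bihom_col C D"
        by (simp add: bihom_col_def smult_col_K_def Const_mult_bihom)
      moreover have "smult_col_K r y \<in> R_col.span (range S)"
        unfolding smult_col_K_def kij(3) e_def by (auto intro: R_col.span_scale R_col.span_base)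
      ultimately show ?case
        using step by (auto simp: bihom_col_def intro: R_col.span_add bihom_add)
    qed
  qed
  moreover have "K_col.dim (K_col.span (e ` I)) = card I"
  proof (rule K_col.dim_span_family[OF fin])
    fix \<phi> assume sum0: "(\<Sum>x\<in>I. smult_col_K (\<phi> x) (e x)) = 0"
    have "\<forall>k. bihom_of_coeffs (C - c k) (D - d k) (\<lambda>i j. \<phi> (k, i, j)) = 0"
      by (rule indep[OF bihom_of_coeffs_bihom]) (rule sum0[unfolded comb])
    then have zero: "bihom_of_coeffs (C - c k) (D - d k) (\<lambda>i j. \<phi> (k, i, j)) = 0" for k ..
    show "\<forall>x\<in>I. \<phi> x = 0"
    proof
      fix x assume "x \<in> I"
      then obtain k i j where "x = (k, i, j)" "i \<le> C - c k" "j \<le> D - d k" by (auto simp: I_def)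
      then show "\<phi> x = 0"
        using lookup_bihom_of_coeffs[of i "C - c k" j "D - d k" "\<lambda>i j. \<phi> (k, i, j)"]
        by (simp add: zero)
    qed
  qed
  moreover have "card I = (\<Sum>k\<in>UNIV. Suc (C - c k) * Suc (D - d k))"
    by (simp add: I_def)
  ultimately show ?thesis by simp
qed

section \<open>From the graded resolution to univariate polynomials\<close>

text \<open>
  Exactness over \<open>A\<close> is used in one degree at a time: the vector \<open>x\<close> is homogenised, written as an
  image under \<open>M\<close>, and the preimage is cut down to its component of the right degree before
  going back to univariate polynomials.
\<close>

lemma hilbert_burch_of_resolution:
  fixes g :: "'a::alg_closed_field poly4 ^ 'n" and M :: "'a poly4 ^ 'm ^ 'n"
  assumes res: "minimal_graded_free_resolution (\<chi> k. n + \<mu> k) (\<chi> i. n) M g"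
    and card: "CARD('n) = Suc CARD('m)" and sum_mu: "sum \<mu> UNIV = n" and n: "0 < n"
  shows "hilbert_burch (\<chi> i j. coeff (dehom (g $ i)) 0) (\<chi> i k. coeff (dehom (M $ i $ k)) 0) \<mu> n"
proof -
  define \<Gamma> :: "'a poly ^ 1 ^ 'n" where "\<Gamma> = (\<chi> i j. coeff (dehom (g $ i)) 0)"
  define N where "N = (\<chi> i k. coeff (dehom (M $ i $ k)) 0)"
  have g: "g $ i \<in> bihom 0 n" and M: "M $ i $ k \<in> bihom 0 (\<mu> k)" for i k
    using res by (simp_all add: minimal_graded_free_resolution_def)
  have im: "(*v) M ` {x. \<forall>j. x $ j \<in> ring_A}
      = {y. (\<forall>i. y $ i \<in> ring_A) \<and> (\<Sum>i\<in>UNIV. g $ i * y $ i) = 0}"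
    using res by (simp add: minimal_graded_free_resolution_def)
  have d\<Gamma>: "dehom (g $ i) = [:\<Gamma> $ i $ j:]" and dN: "dehom (M $ i $ k) = [:N $ i $ k:]" for i j k
    using dehom_bihom_0[OF g] dehom_bihom_0[OF M] by (simp_all add: \<Gamma>_def N_def)
  have "(\<Sum>i\<in>UNIV. \<Gamma> $ i $ j * N $ i $ k) = 0" for j k
  proof -
    have "\<forall>l. axis k 1 $ l \<in> (ring_A :: 'a poly4 set)"
      by (auto simp: axis_def ring_A_def)
    then have "(\<Sum>i\<in>UNIV. g $ i * (M *v axis k 1) $ i) = 0" using im by blast
    then have "(\<Sum>i\<in>UNIV. g $ i * M $ i $ k) = 0"
      by (simp add: matrix_vector_mult_def axis_def if_distrib[of "\<lambda>t. _ * t"] cong: if_cong)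
    from arg_cong[OF this, of dehom]
    have "(\<Sum>i\<in>UNIV. [:\<Gamma> $ i $ j:] * [:N $ i $ k:]) = 0"
      by (simp only: dehom_sum dehom_mult d\<Gamma>[of _ j] dN dehom_0)
    from arg_cong[OF this, of "\<lambda>p. coeff p 0"] show ?thesis by (simp add: coeff_sum mult.commute)
  qed
  note \<Gamma>N = this
  have "hilbert_burch \<Gamma> N \<mu> n"
  proof
    show "CARD('n) = Suc CARD('m)" "sum \<mu> UNIV = n" "0 < n" by fact+
    show "\<Gamma> $ i $ 1 \<in> polys_below (Suc n)" for i
      using coeff_dehom_polys_below[OF g] by (simp add: \<Gamma>_def)
    show "N $ i $ k \<in> polys_below (Suc (\<mu> k))" for i k
      using coeff_dehom_polys_below[OF M] by (simp add: N_def)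
    show "(N *v y) v* \<Gamma> = 0" for y
    proof -
      have "((N *v y) v* \<Gamma>) $ j = (\<Sum>k\<in>UNIV. (\<Sum>i\<in>UNIV. \<Gamma> $ i $ j * N $ i $ k) * y $ k)" for j
        unfolding matrix_vector_mult_def vector_matrix_mult_def vec_lambda_beta
          sum_distrib_left sum_distrib_right
        by (subst sum.swap) (simp only: mult_ac)
      then show ?thesis unfolding \<Gamma>N by (simp add: vec_eq_iff)
    qed
    fix d x assume x: "x \<in> pbox (\<lambda>_. d)" "x v* \<Gamma> = 0"
    show "\<exists>y\<in>pbox (\<lambda>k. d - \<mu> k). N *v y = x"
    proof (cases d)
      case 0
      then have "x = 0" using x(1) by (simp add: pbox_def vec_eq_iff)
      then show ?thesis by (intro bexI[of _ 0]) (auto simp: pbox_def)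
    next
      case (Suc e)
      define F where "F = (\<chi> i. homog 0 e [:x $ i:])"
      have F: "F $ i \<in> bihom 0 e" for i by (simp add: F_def homog_bihom)
      have dF: "dehom (F $ i) = [:x $ i:]" for i
        unfolding F_def vec_lambda_beta
        using x(1) Suc by (intro dehom_homog) (auto simp: polys_below_def pbox_def coeff_pCons split: nat.splits)
      have "(\<Sum>i\<in>UNIV. g $ i * F $ i) = 0"
      proof (rule dehom_eq_0)
        show "(\<Sum>i\<in>UNIV. g $ i * F $ i) \<in> bihom 0 (n + e)"
          using bihom_mult[OF g F] by (auto intro: bihom_sum)
        have "dehom (\<Sum>i\<in>UNIV. g $ i * F $ i) = [:(x v* \<Gamma>) $ 1:]"
          unfolding dehom_sum dehom_mult dF d\<Gamma>[of _ 1]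
          by (simp add: poly_eq_iff coeff_sum vector_matrix_mult_def coeff_pCons split: nat.splits)
        then show "dehom (\<Sum>i\<in>UNIV. g $ i * F $ i) = 0" unfolding x(2) by simp
      qed
      moreover have "\<forall>i. F $ i \<in> ring_A" using F bihom_subset_ring_A by blast
      ultimately have "F \<in> (*v) M ` {x. \<forall>j. x $ j \<in> ring_A}" unfolding im by blast
      then obtain X where X: "F = M *v X" by blast
      define Y where "Y k = (if \<mu> k \<le> e then bicomp 0 (e - \<mu> k) (X $ k) else 0)" for k
      have FY: "F $ i = (\<Sum>k\<in>UNIV. M $ i $ k * Y k)" for i
      proof -
        have "F $ i = bicomp 0 e (F $ i)" by (simp add: bicomp_id F)
        also have "\<dots> = (\<Sum>k\<in>UNIV. bicomp 0 e (X $ k * M $ i $ k))"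
          by (simp add: X matrix_vector_mult_def bicomp_sum mult.commute)
        also have "\<dots> = (\<Sum>k\<in>UNIV. M $ i $ k * Y k)"
          by (intro sum.cong refl) (auto simp: bicomp_mult[OF M] Y_def mult.commute)
        finally show ?thesis .
      qed
      have Ybi: "Y k \<in> bihom 0 (e - \<mu> k)" for k by (simp add: Y_def bicomp_bihom)
      let ?y = "\<chi> k. coeff (dehom (Y k)) 0"
      have "?y \<in> pbox (\<lambda>k. d - \<mu> k)"
      proof -
        have "coeff (dehom (Y k)) 0 \<in> polys_below (d - \<mu> k)" for k
        proof (cases "\<mu> k \<le> e")
          case True
          then show ?thesis using coeff_dehom_polys_below[OF Ybi, of k 0] Suc by (simp add: Suc_diff_le)
        next
          case False
          then have "Y k = 0" by (simp add: Y_def)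
          then show ?thesis by simp
        qed
        then show ?thesis by (simp add: pbox_def)
      qed
      moreover have "(N *v ?y) $ i = x $ i" for i
      proof -
        have "[:x $ i:] = (\<Sum>k\<in>UNIV. [:N $ i $ k:] * [:?y $ k:])"
          using arg_cong[OF FY, of dehom i] dehom_bihom_0[OF Ybi]
          unfolding dF dehom_sum dehom_mult dN by simp
        from arg_cong[OF this, of "\<lambda>p. coeff p 0"] show ?thesis
          by (simp add: coeff_sum matrix_vector_mult_def mult.commute)
      qed
      ultimately show ?thesis by (auto simp: vec_eq_iff)
    qed
  qed
  then show ?thesis unfolding \<Gamma>_def N_def .
qed


section \<open>Change of basis\<close>

lemma Const_0 [simp]: "Const 0 = 0"
  by (simp add: Const_def)

lemma Const_sum: "Const (sum f A) = (\<Sum>i\<in>A. Const (f i))"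
  by (induction A rule: infinite_finite_induct) (auto simp: Const_add)

lemma single_sum: "Poly_Mapping.single m (sum h A) = (\<Sum>k\<in>A. Poly_Mapping.single m (h k))"
  by (induction A rule: infinite_finite_induct) (auto simp: single_add)

lemma basis_family_coeffs:
  assumes "basis_family f V" "x \<in> V"
  shows "\<exists>c. x = (\<Sum>i\<in>UNIV. Const (c i) * f $ i)"
proof -
  have inj: "inj (\<lambda>i. f $ i)" and "x \<in> K_poly.span (range (\<lambda>i. f $ i))"
    using assms by (auto simp: basis_family_def)
  then obtain u where "x = (\<Sum>v\<in>range (\<lambda>i. f $ i). smult_K (u v) v)"
    by (auto simp: K_poly.span_finite)
  also have "\<dots> = (\<Sum>i\<in>UNIV. Const (u (f $ i)) * f $ i)"
    using inj by (simp add: sum.reindex smult_K_def)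
  finally show ?thesis by (intro exI[of _ "\<lambda>i. u (f $ i)"])
qed

lemma basis_family_independent:
  assumes "basis_family f V" "(\<Sum>i\<in>UNIV. Const (c i) * f $ i) = 0"
  shows "c i = 0"
proof -
  have inj: "inj (\<lambda>i. f $ i)" and ind: "\<not> K_poly.dependent (range (\<lambda>i. f $ i))"
    using assms(1) by (auto simp: basis_family_def)
  have "(\<Sum>v\<in>range (\<lambda>i. f $ i). smult_K (c (inv (\<lambda>i. f $ i) v)) v) = 0"
    using assms(2) inj by (simp add: sum.reindex smult_K_def)
  from K_poly.independentD[OF ind _ subset_refl this]
  have "c (inv (\<lambda>i. f $ i) (f $ i)) = 0" by simp
  then show ?thesis using inv_f_f[OF inj, of i] by simp
qed

text \<open>
  Both families have the same number of members, so there is no room for a further vector of \<open>U\<close>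
  outside \<open>V\<close>.
\<close>

lemma basis_family_of_subspace:
  fixes p f :: "'a::field poly4 ^ 'n"
  assumes p: "basis_family p U" and f: "basis_family f V" and VU: "V \<subseteq> U"
  shows "V = U"
proof (rule ccontr)
  assume "V \<noteq> U"
  then obtain w where w: "w \<in> U" "w \<notin> V" using VU by auto
  let ?F = "range (\<lambda>i. f $ i)"
  have "\<not> K_poly.dependent (insert w ?F)"
    using f w(2) K_poly.independent_insertI[of w ?F] by (auto simp: basis_family_def)
  moreover have "insert w ?F \<subseteq> K_poly.span (range (\<lambda>i. p $ i))"
    using f p VU w(1) K_poly.span_base[of _ ?F] by (auto simp: basis_family_def)
  ultimately have "card (insert w ?F) \<le> card (range (\<lambda>i. p $ i))"
    using K_poly.independent_span_bound[of "range (\<lambda>i. p $ i)" "insert w ?F"] by auto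
  moreover have "w \<notin> ?F" using w(2) f K_poly.span_base[of w ?F] by (auto simp: basis_family_def)
  ultimately show False using f p by (simp add: basis_family_def card_image)
qed

text \<open>
  The matrix \<open>D\<close> turns syzygies with respect to \<open>f\<close> into syzygies with respect to \<open>p\<close>. Of its
  invertibility only the injectivity on columns over \<open>R\<close> is recorded, which is what carries
  independence over.
\<close>

lemma change_of_basis:
  fixes p f :: "'a::field poly4 ^ 'n"
  assumes p: "basis_family p U" and f: "basis_family f U"
  shows "\<exists>D :: 'a ^ 'n ^ 'n. (\<forall>j. f $ j = (\<Sum>i\<in>UNIV. Const (D $ i $ j) * p $ i)) \<and>
    (\<forall>T. (\<forall>i. (\<Sum>j\<in>UNIV. Const (D $ i $ j) * T $ j) = 0) \<longrightarrow> T = (0 :: 'a poly4 ^ 'n))"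
proof -
  have "f $ j \<in> U" "p $ j \<in> U" for j
    using p f K_poly.span_base[of _ "range (\<lambda>i. f $ i)"] K_poly.span_base[of _ "range (\<lambda>i. p $ i)"]
    by (auto simp: basis_family_def)
  then have exD: "\<forall>j. \<exists>c. f $ j = (\<Sum>i\<in>UNIV. Const (c i) * p $ i)"
    and exE: "\<forall>i. \<exists>c. p $ i = (\<Sum>k\<in>UNIV. Const (c k) * f $ k)"
    using basis_family_coeffs[OF p] basis_family_coeffs[OF f] by blast+
  obtain D where D: "\<And>j. f $ j = (\<Sum>i\<in>UNIV. Const (D j i) * p $ i)"
    using choice[OF exD] by blast
  obtain E where E: "\<And>i. p $ i = (\<Sum>k\<in>UNIV. Const (E i k) * f $ k)"
    using choice[OF exE] by blast
  have ED: "(\<Sum>i\<in>UNIV. E i k * D j i) = (if k = j then 1 else 0)" for k j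
  proof -
    have "f $ j = (\<Sum>i\<in>UNIV. Const (D j i) * (\<Sum>k\<in>UNIV. Const (E i k) * f $ k))"
      using D[of j] by (simp flip: E)
    also have "\<dots> = (\<Sum>k\<in>UNIV. Const (\<Sum>i\<in>UNIV. E i k * D j i) * f $ k)"
      unfolding sum_distrib_left Const_sum sum_distrib_right Const_mult
      by (subst sum.swap) (simp only: mult_ac)
    finally have "(\<Sum>k\<in>UNIV. Const ((\<Sum>i\<in>UNIV. E i k * D j i) - (if k = j then 1 else 0)) * f $ k) = 0"
      by (simp add: Const_def single_diff left_diff_distrib sum_subtractf if_distrib[of "Poly_Mapping.single 0"]
          if_distrib[of "\<lambda>t. t * _"] cong: if_cong)
    from basis_family_independent[OF f this] show ?thesis by simp
  qed
  have "T = 0" if T: "\<forall>i. (\<Sum>j\<in>UNIV. Const (D j i) * T $ j) = 0" for T :: "'a poly4 ^ 'n"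
  proof -
    have "T $ k = 0" for k
    proof -
      have "T $ k = (\<Sum>j\<in>UNIV. Const (if k = j then 1 else 0) * T $ j)"
        by (simp add: if_distrib[of Const] if_distrib[of "\<lambda>t. t * _"] Const_1 cong: if_cong)
      also have "\<dots> = (\<Sum>j\<in>UNIV. Const (\<Sum>i\<in>UNIV. E i k * D j i) * T $ j)" by (simp only: ED)
      also have "\<dots> = (\<Sum>i\<in>UNIV. Const (E i k) * (\<Sum>j\<in>UNIV. Const (D j i) * T $ j))"
        unfolding sum_distrib_left Const_sum sum_distrib_right Const_mult
        by (subst sum.swap) (simp only: mult_ac)
      finally show ?thesis using T by simp
    qed
    then show ?thesis by (simp add: vec_eq_iff)
  qed
  then show ?thesis using D by (intro exI[of _ "\<chi> i j. D j i"]) auto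
qed

section \<open>The syzygies of a basepoint free subspace\<close>

text \<open>
  The generators \<open>g\<close> are the coordinates of the syzygy \<open>S\<close> with respect to the new basis \<open>f\<close>:
  the two expressions of \<open>assoc_f\<close> are compared coefficientwise in the basis \<open>p\<close>.
\<close>

lemma syzygy_coordinates:
  fixes p S f :: "'a::field poly4 ^ 'n" and B :: "'n \<Rightarrow> nat \<Rightarrow> 'a"
  assumes p: "basis_family p U" and S: "S \<in> bihom_col 0 n"
    and D: "\<And>j. f $ j = (\<Sum>i\<in>UNIV. Const (D $ i $ j) * p $ i)"
    and B: "\<forall>j\<le>n. assoc_f p S n j = (\<Sum>i\<in>UNIV. smult_K (B i j) (f $ i))"
    and g: "\<forall>i. g $ i = (\<Sum>j\<le>n. Poly_Mapping.single (uv_monom (n - j) j) (B i j))"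
  shows "S $ i = (\<Sum>k\<in>UNIV. Const (D $ i $ k) * g $ k)"
proof -
  have coeff: "syz_coeff S n i j = (\<Sum>k\<in>UNIV. D $ i $ k * B k j)" if "j \<le> n" for i j
  proof -
    have "(\<Sum>i\<in>UNIV. Const (syz_coeff S n i j) * p $ i)
        = (\<Sum>k\<in>UNIV. Const (B k j) * (\<Sum>i\<in>UNIV. Const (D $ i $ k) * p $ i))"
      using B that by (simp add: assoc_f_def smult_K_def flip: D)
    also have "\<dots> = (\<Sum>i\<in>UNIV. Const (\<Sum>k\<in>UNIV. D $ i $ k * B k j) * p $ i)"
      unfolding sum_distrib_left Const_sum sum_distrib_right Const_mult
      by (subst sum.swap) (simp only: mult_ac)
    finally have "(\<Sum>i\<in>UNIV. Const (syz_coeff S n i j - (\<Sum>k\<in>UNIV. D $ i $ k * B k j)) * p $ i) = 0"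
      by (simp add: Const_def single_diff left_diff_distrib sum_subtractf)
    from basis_family_independent[OF p this] show ?thesis by simp
  qed
  have uv: "uv_monom (n - j) j = mono4 0 0 (n - j) j" for j
    by (simp add: mono4_def)
  have bij: "bij_betw (\<lambda>j. n - j) {..n} {..n}"
    by (rule bij_betwI[of _ _ _ "\<lambda>j. n - j"]) auto
  have "S $ i = (\<Sum>j\<le>n. Poly_Mapping.single (mono4 0 0 j (n - j))
      (Poly_Mapping.lookup (S $ i) (mono4 0 0 j (n - j))))"
    using bihom_expand[of "S $ i" 0 n] S by (simp add: bihom_of_coeffs_def bihom_col_def)
  also have "\<dots> = (\<Sum>j\<le>n. Poly_Mapping.single (uv_monom (n - j) j) (syz_coeff S n i j))"
    by (subst sum.reindex_bij_betw[OF bij, symmetric]) (simp add: syz_coeff_def uv)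
  also have "\<dots> = (\<Sum>j\<le>n. \<Sum>k\<in>UNIV. Const (D $ i $ k) * Poly_Mapping.single (uv_monom (n - j) j) (B k j))"
    by (simp add: coeff Const_def mult_single single_sum)
  also have "\<dots> = (\<Sum>k\<in>UNIV. Const (D $ i $ k) * g $ k)"
    using g by (subst sum.swap) (simp add: sum_distrib_left)
  finally show ?thesis .
qed

text \<open>
  Basepoint freeness at the points \<open>((x : 1), (y : 1))\<close> and \<open>((1 : 0), (y : 1))\<close>. These
  are all points of the lines with fixed \<open>(u : v)\<close> except the one with \<open>v = 0\<close>, and that is enough
  since a polynomial in \<open>u\<close> is determined by its values.
\<close>

lemma basepoint_free_dehom:
  fixes f :: "'a::field poly4 ^ 'n"
  assumes U: "U \<subseteq> bihom a b" "basepoint_free U" and f: "basis_family f U"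
  shows "\<exists>i. poly (poly (dehom (f $ i)) [:x:]) y \<noteq> 0"
    and "\<exists>i. poly (coeff (dehom (f $ i)) a) y \<noteq> 0"
proof -
  have dehom_U: "\<exists>c. dehom q = (\<Sum>i\<in>UNIV. [:[:c i:]:] * dehom (f $ i))" if "q \<in> U" for q
    using basis_family_coeffs[OF f that] by (auto simp: dehom_sum dehom_mult dehom_Const)
  show "\<exists>i. poly (poly (dehom (f $ i)) [:x:]) y \<noteq> 0"
  proof (rule ccontr)
    assume *: "\<not> ?thesis"
    let ?x = "\<lambda>v. case v of Var_s \<Rightarrow> x | Var_t \<Rightarrow> 1 | Var_u \<Rightarrow> y | Var_v \<Rightarrow> 1"
    have "poly4_eval ?x q = 0" if q: "q \<in> U" for q
    proof -
      obtain c where c: "dehom q = (\<Sum>i\<in>UNIV. [:[:c i:]:] * dehom (f $ i))" using dehom_U[OF q] ..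
      show ?thesis using * by (simp add: poly4_eval_affine c poly_sum)
    qed
    then show False using U(2) by (auto simp: basepoint_free_def dest!: spec[of _ ?x])
  qed
  show "\<exists>i. poly (coeff (dehom (f $ i)) a) y \<noteq> 0"
  proof (rule ccontr)
    assume *: "\<not> ?thesis"
    let ?x = "\<lambda>v. case v of Var_s \<Rightarrow> 1 | Var_t \<Rightarrow> 0 | Var_u \<Rightarrow> y | Var_v \<Rightarrow> 1"
    have "poly4_eval ?x q = 0" if q: "q \<in> U" for q
    proof -
      obtain c where c: "dehom q = (\<Sum>i\<in>UNIV. [:[:c i:]:] * dehom (f $ i))" using dehom_U[OF q] ..
      show ?thesis using * U(1) q by (subst poly4_eval_infinity) (auto simp: c poly_sum coeff_sum)
    qed
    then show False using U(2) by (auto simp: basepoint_free_def dest!: spec[of _ ?x])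
  qed
qed

theorem theorem6p8:
  fixes a b n \<mu>1 \<mu>2 :: nat
    and U :: "'a::alg_closed_field poly4 set"
    and p S :: "'a poly4 ^ 4"
  assumes "a \<ge> 1" and "b \<ge> 1"
    and "U \<subseteq> bihom a b" and "basis_family p U"
    and "basepoint_free U"
    and "is_syzygy_of_bidegree p 0 n S" and "S \<noteq> 0"
    and "b \<ge> 2 * n - 1"
    and "\<forall>m<n. \<forall>T. is_syzygy_of_bidegree p 0 m T \<longrightarrow> T = 0"
    and "K_poly.dim (assoc_V p S n) = 4"
    and "assoc_mu p S n \<mu>1 \<mu>2"
  shows "\<exists>S1 S2 S3.
      is_syzygy_of_bidegree p a (b - n + \<mu>1) S1 \<and>
      is_syzygy_of_bidegree p a (b - n + \<mu>2) S2 \<and>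
      is_syzygy_of_bidegree p a (b - \<mu>1 - \<mu>2) S3 \<and>
      K_col.dim (R_col.span {S, S1, S2, S3} \<inter> bihom_col (2 * a - 1) (b - 1)) = 2 * a * b"
proof -
  have p: "basis_family p U" by fact
  have S: "S \<in> bihom_col 0 n" and Ssyz: "(\<Sum>i\<in>UNIV. p $ i * S $ i) = 0"
    using assms(6) by (auto simp: is_syzygy_of_bidegree_def is_syzygy_def)
  obtain f g :: "'a poly4 ^ 4" and B and M :: "'a poly4 ^ 3 ^ 4" where
    f: "basis_family f (assoc_V p S n)"
    and B: "\<forall>j\<le>n. assoc_f p S n j = (\<Sum>i\<in>UNIV. smult_K (B i j) (f $ i))"
    and g: "\<forall>i. g $ i = (\<Sum>j\<le>n. Poly_Mapping.single (uv_monom (n - j) j) (B i j))"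
    and res: "minimal_graded_free_resolution (vector [n + \<mu>1, n + \<mu>2, 2 * n - \<mu>1 - \<mu>2]) (\<chi> i. n) M g"
    and mu: "1 \<le> \<mu>1" "\<mu>1 \<le> \<mu>2" "\<mu>2 \<le> n - \<mu>1 - \<mu>2"
    using assms(11) unfolding assoc_mu_def by blast
  define \<mu> :: "3 \<Rightarrow> nat" where "\<mu> k = (if k = 1 then \<mu>1 else if k = 2 then \<mu>2 else n - \<mu>1 - \<mu>2)" for k
  have mu123: "\<mu> 1 = \<mu>1" "\<mu> 2 = \<mu>2" "\<mu> 3 = n - \<mu>1 - \<mu>2" by (simp_all add: \<mu>_def)
  have mun: "\<mu> k < n" for k using mu by (auto simp: \<mu>_def)
  have sum_mu: "sum \<mu> UNIV = n" using mu by (simp add: sum_3 mu123)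
  have n2: "2 \<le> n" using mu by simp
  then have b: "2 * n \<le> Suc b" "n < b" using assms(8) by auto
  have "vector [n + \<mu>1, n + \<mu>2, 2 * n - \<mu>1 - \<mu>2] = (\<chi> k. n + \<mu> k)"
    using mu by (auto simp: vec_eq_iff forall_3 mu123 vector_3)
  with res have res': "minimal_graded_free_resolution (\<chi> k. n + \<mu> k) (\<chi> i. n) M g" by simp
  let ?\<Gamma> = "\<chi> i j. coeff (dehom (g $ i)) 0 :: 'a poly ^ 1 ^ 4"
  have hb: "hilbert_burch ?\<Gamma> (\<chi> i k. coeff (dehom (M $ i $ k)) 0) \<mu> n"
    using hilbert_burch_of_resolution[OF res'] sum_mu n2 by simp
  have gn: "g $ i \<in> bihom 0 n" for i
    using res' by (simp add: minimal_graded_free_resolution_def)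

  have "assoc_f p S n j \<in> U" for j
  proof -
    have "assoc_f p S n j \<in> K_poly.span (range (\<lambda>i. p $ i))"
      unfolding assoc_f_def by (intro K_poly.span_sum K_poly.span_scale K_poly.span_base rangeI)
    then show ?thesis using p by (simp add: basis_family_def)
  qed
  then have "assoc_V p S n \<subseteq> U"
    using p unfolding assoc_V_def basis_family_def
    by (metis K_poly.span_minimal K_poly.subspace_span image_subsetI)
  with p f have "assoc_V p S n = U" by (intro basis_family_of_subspace)
  with f have f: "basis_family f U" by simp
  have fU: "f $ i \<in> bihom a b" for i
    using f assms(3) K_poly.span_base[of "f $ i" "range (\<lambda>i. f $ i)"] by (auto simp: basis_family_def)
  obtain D :: "'a ^ 4 ^ 4" where D: "\<And>j. f $ j = (\<Sum>i\<in>UNIV. Const (D $ i $ j) * p $ i)"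
    and Dinj: "\<And>T. (\<And>i. (\<Sum>j\<in>UNIV. Const (D $ i $ j) * T $ j) = 0) \<Longrightarrow> T = (0 :: 'a poly4 ^ 4)"
    using change_of_basis[OF p f] by blast
  have transfer: "(\<Sum>i\<in>UNIV. p $ i * (\<Sum>j\<in>UNIV. Const (D $ i $ j) * T $ j)) = (\<Sum>j\<in>UNIV. f $ j * T $ j)"
    for T :: "'a poly4 ^ 4"
    unfolding D sum_distrib_left sum_distrib_right by (subst sum.swap) (simp only: mult_ac)
  have SD: "S $ i = (\<Sum>k\<in>UNIV. Const (D $ i $ k) * g $ k)" for i
    by (rule syzygy_coordinates[OF p S D B g])
  have fg: "(\<Sum>j\<in>UNIV. f $ j * g $ j) = 0"
    using Ssyz unfolding SD transfer .

  let ?f = "\<chi> i. dehom (f $ i)"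
  have "\<exists>T. (\<forall>k. T k \<in> bbox (Suc a) (\<lambda>_. Suc (b - n + \<mu> k)) \<and> (\<Sum>i\<in>UNIV. ?f $ i * T k $ i) = 0) \<and>
    (\<forall>l r. (\<forall>k. r $ k \<in> polys_below a) \<longrightarrow>
       (\<forall>i. l * [:?\<Gamma> $ i $ 1:] + (\<Sum>k\<in>UNIV. r $ k * T k $ i) = 0) \<longrightarrow> l = 0 \<and> r = 0)"
  proof (rule syzygies_from_koszul[OF hb])
    show "?f \<in> bbox (Suc a) (\<lambda>_. Suc b)"
      using coeff_dehom_polys_below[OF fU] dehom_polys_below[OF fU]
      by (auto simp: bbox_def pbox_def vec_eq_iff polys_below_def)
    have "(\<Sum>j\<in>UNIV. dehom (f $ j) * [:coeff (dehom (g $ j)) 0:]) = 0"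
      using arg_cong[OF fg, of dehom] by (simp add: dehom_sum dehom_mult flip: dehom_bihom_0[OF gn])
    then show "?f v* cmat ?\<Gamma> = 0"
      by (simp add: vec_eq_iff vector_matrix_mult_def mult.commute)
    show "2 * n \<le> Suc b" by fact
    show "\<exists>i. poly (poly (?f $ i) [:x:]) y \<noteq> 0" for x y
      using basepoint_free_dehom(1)[OF assms(3,5) f] by simp
    show "\<exists>i. poly (coeff (?f $ i) a) y \<noteq> 0" for y
      using basepoint_free_dehom(2)[OF assms(3,5) f] by simp
  qed
  then obtain T where T: "\<And>k. T k \<in> bbox (Suc a) (\<lambda>_. Suc (b - n + \<mu> k))"
    "\<And>k. (\<Sum>i\<in>UNIV. dehom (f $ i) * T k $ i) = 0"
    and Tindep: "\<And>l r. (\<And>k. r $ k \<in> polys_below a) \<Longrightarrow>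
       (\<And>i. l * dehom (g $ i) + (\<Sum>k\<in>UNIV. r $ k * T k $ i) = 0) \<Longrightarrow> l = 0 \<and> r = 0"
    by (auto simp flip: dehom_bihom_0[OF gn])

  define H where "H k = (\<chi> i. homog a (b - n + \<mu> k) (T k $ i))" for k
  have H: "H k $ i \<in> bihom a (b - n + \<mu> k)" for k i by (simp add: H_def homog_bihom)
  have dH: "dehom (H k $ i) = T k $ i" for k i
    unfolding H_def vec_lambda_beta using T(1)[of k]
    by (intro dehom_homog) (auto simp: bbox_def pbox_def vec_eq_iff polys_below_def)
  have Hsyz: "(\<Sum>i\<in>UNIV. f $ i * H k $ i) = 0" for k
  proof (rule dehom_eq_0)
    show "(\<Sum>i\<in>UNIV. f $ i * H k $ i) \<in> bihom (a + a) (b + (b - n + \<mu> k))"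
      by (intro bihom_sum bihom_mult fU H)
    show "dehom (\<Sum>i\<in>UNIV. f $ i * H k $ i) = 0" by (simp add: dehom_sum dehom_mult dH T(2))
  qed
  \<comment> \<open>The four syzygies are indexed by \<open>3 option\<close>: \<open>None\<close> stands for \<open>S\<close>, whose degree in \<open>s, t\<close>
    is zero, and \<open>Some k\<close> for the lift of the Koszul syzygy number \<open>k\<close>.\<close>
  define W where "W x = (case x of None \<Rightarrow> S
    | Some k \<Rightarrow> \<chi> i. \<Sum>j\<in>UNIV. Const (D $ i $ j) * H k $ j)" for x
  define c where "c x = (case x of None \<Rightarrow> 0 | Some (k :: 3) \<Rightarrow> a)" for x
  define d where "d x = (case x of None \<Rightarrow> n | Some k \<Rightarrow> b - n + \<mu> k)" for x
  have W: "W x \<in> bihom_col (c x) (d x)" for x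
    using S H by (cases x) (auto simp: W_def c_def d_def bihom_col_def intro!: bihom_sum Const_mult_bihom)
  have Wsyz: "is_syzygy_of_bidegree p a (b - n + \<mu> k) (W (Some k))" for k
    using W[of "Some k"] transfer[of "H k"] Hsyz[of k]
    by (simp add: is_syzygy_of_bidegree_def is_syzygy_def W_def c_def d_def)
  have cd: "c x \<le> 2 * a - 1" "d x \<le> b - 1" for x
  proof -
    have "b - n + \<mu> k \<le> b - 1" for k using mun[of k] b(2) by linarith
    then show "c x \<le> 2 * a - 1" "d x \<le> b - 1"
      using assms(1) b(2) by (auto simp: c_def d_def split: option.split)
  qed
  have "K_col.dim (R_col.span (range W) \<inter> bihom_col (2 * a - 1) (b - 1))
    = (\<Sum>x\<in>UNIV. Suc (2 * a - 1 - c x) * Suc (b - 1 - d x))"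
  proof (rule dim_span_bihom_component[OF W cd])
    fix q assume q: "\<And>x. q x \<in> bihom (2 * a - 1 - c x) (b - 1 - d x)"
      and zero: "(\<Sum>x\<in>UNIV. q x *s W x) = 0"
    have opt: "(\<Sum>x\<in>UNIV. \<phi> x) = \<phi> None + (\<Sum>k\<in>UNIV. \<phi> (Some k))"
      for \<phi> :: "3 option \<Rightarrow> 'a poly4"
      by (simp add: UNIV_option_conv sum.reindex)
    let ?v = "\<chi> j. q None * g $ j + (\<Sum>k\<in>UNIV. q (Some k) * H k $ j)"
    \<comment> \<open>The relation, transported back to the basis \<open>f\<close>, where \<open>S\<close> has the coordinates \<open>g\<close>.\<close>
    have "(\<Sum>j\<in>UNIV. Const (D $ i $ j) * ?v $ j) = (\<Sum>x\<in>UNIV. q x *s W x) $ i" for i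
    proof -
      have "(\<Sum>x\<in>UNIV. q x *s W x) $ i = q None * (\<Sum>j\<in>UNIV. Const (D $ i $ j) * g $ j)
          + (\<Sum>k\<in>UNIV. q (Some k) * (\<Sum>j\<in>UNIV. Const (D $ i $ j) * H k $ j))"
        by (simp add: opt W_def flip: SD)
      also have "\<dots> = (\<Sum>j\<in>UNIV. Const (D $ i $ j) * (q None * g $ j))
          + (\<Sum>j\<in>UNIV. \<Sum>k\<in>UNIV. Const (D $ i $ j) * (q (Some k) * H k $ j))"
        unfolding sum_distrib_left
        by (intro arg_cong2[of _ _ _ _ "(+)"], simp only: mult_ac, subst sum.swap, simp only: mult_ac)
      finally show ?thesis by (simp add: distrib_left sum.distrib sum_distrib_left)
    qed
    then have "?v = 0" unfolding zero by (intro Dinj) simp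
    then have v: "q None * g $ j + (\<Sum>k\<in>UNIV. q (Some k) * H k $ j) = 0" for j
      by (simp add: vec_eq_iff)
    have "dehom (q None) = 0 \<and> (\<chi> k. dehom (q (Some k))) = 0"
    proof (rule Tindep)
      show "(\<chi> k. dehom (q (Some k))) $ k \<in> polys_below a" for k
        using dehom_polys_below[OF q, of "Some k"] assms(1) by (simp add: c_def)
      show "dehom (q None) * dehom (g $ i)
          + (\<Sum>k\<in>UNIV. (\<chi> k. dehom (q (Some k))) $ k * T k $ i) = 0" for i
        using arg_cong[OF v, of dehom i] by (simp add: dehom_add dehom_sum dehom_mult dH)
    qed
    then have "dehom (q x) = 0" for x by (cases x) (auto simp: vec_eq_iff)
    then show "\<forall>x. q x = 0" using dehom_eq_0[OF q] by blast
  qed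
  also have "\<dots> = 2 * a * (b - n) + (\<Sum>k\<in>(UNIV :: 3 set). a * (n - \<mu> k))"
  proof -
    have "Suc (2 * a - 1 - c None) = 2 * a" "Suc (b - 1 - d None) = b - n"
      using assms(1) b(2) by (auto simp: c_def d_def)
    moreover have "Suc (2 * a - 1 - c (Some k)) = a" "Suc (b - 1 - d (Some k)) = n - \<mu> k" for k
    proof -
      show "Suc (2 * a - 1 - c (Some k)) = a" using assms(1) by (simp add: c_def)
      have "Suc (b - 1 - (b - n + \<mu> k)) = n - \<mu> k" using b(2) mun[of k] by linarith
      then show "Suc (b - 1 - d (Some k)) = n - \<mu> k" by (simp add: d_def)
    qed
    moreover have "(\<Sum>x\<in>UNIV. \<phi> x) = \<phi> None + (\<Sum>k\<in>UNIV. \<phi> (Some k))"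
      for \<phi> :: "3 option \<Rightarrow> nat"
      by (simp add: UNIV_option_conv sum.reindex)
    ultimately show ?thesis by (simp only:)
  qed
  also have "\<dots> = 2 * a * (b - n) + a * (2 * n)"
  proof -
    have "(\<Sum>k\<in>(UNIV :: 3 set). n - \<mu> k) = 2 * n"
      using mun by (subst sum_subtractf_nat) (auto simp: sum_mu less_imp_le)
    then show ?thesis by (simp flip: sum_distrib_left)
  qed
  also have "\<dots> = 2 * a * b" using b(2) by (auto dest!: less_imp_Suc_add simp: algebra_simps)
  finally have dim: "K_col.dim (R_col.span (range W) \<inter> bihom_col (2 * a - 1) (b - 1)) = 2 * a * b" .
  have "range W = {S, W (Some 1), W (Some 2), W (Some 3)}"
    by (simp add: UNIV_option_conv UNIV_3 W_def)
  moreover have "b - n + \<mu> 3 = b - \<mu>1 - \<mu>2" using mu b by (simp add: mu123)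
  ultimately show ?thesis
    using dim Wsyz[of 1] Wsyz[of 2] Wsyz[of 3] unfolding mu123(1,2)
    by (intro exI[of _ "W (Some 1)"] exI[of _ "W (Some 2)"] exI[of _ "W (Some 3)"]) simp
qed

end
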